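(* Let $\Gamma$ be a singular branch of plane curve. Then $n,\overline\beta_1,\dots,\overline\beta_g$ all belong to the $\mathcal S$-basis of values of $\Gamma$, i.e. the minimal generating set of $\Lambda_\Gamma$ as a semimodule over $\mathcal S_\Gamma$ contains the minimal generating set $\{n,\overline\beta_1,\dots,\overline\beta_g\}$ of the semigroup $\mathcal S_\Gamma$.
   Context: Let $\Gamma$ be a singular irreducible germ of holomorphic curve at $0\in\mathbb C^2$ with Puiseux parametrization $\Gamma(t)=(t^n,\sum_{\beta\ge\beta_1}a_{\beta,\Gamma}t^\beta)$, $n\ge2$ its multiplicity, $\beta_1<\dots<\beta_g$ its Puiseux characteristic exponents. Put $e_0=n$, $e_j=\gcd(e_{j-1},\beta_j)$, $n_j=e_{j-1}/e_j$; $\overline\beta_1=\beta_1$, $\overline\beta_j=n_{j-1}\overline\beta_{j-1}-\beta_{j-1}+\beta_j$ ($2\le j\le g$). For $f\in\mathbb C[[x,y]]$, $\nu_\Gamma(f)=\mathrm{ord}_tf(\Gamma(t))$; for a 1-form $\omega$ with $\Gamma^*\omega=h(t)dt$, $\nu_\Gamma(\omega)=\mathrm{ord}_th+1$. $\mathcal S_\Gamma=\{\nu_\Gamma(f):f\in\mathbb C\{x,y\},f(0)=0\}$, minimally generated by $n,\overline\beta_1,\dots,\overline\beta_g$; $\Lambda_\Gamma=\{\nu_\Gamma(\omega):\omega$ germ of holomorphic 1-form$\}\setminus\{\infty\}$. An $\mathcal S$-collection is $S\subset\mathbb Z_{>0}$ with $S+\mathcal S_\Gamma\subset S$; the $\mathcal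 S$-basis of values of $\Gamma$ is the minimal subset $T$ of $\Lambda_\Gamma$ with $T+(\mathcal S_\Gamma\cup\{0\})=\Lambda_\Gamma$. *)

theory Defs
  imports "HOL-Analysis.Analysis"
begin

text \<open>A branch Gamma is given by its Puiseux parametrization t |-> (t^n, phi(t)),
  phi a convergent power series.  Germs of holomorphic functions at 0 in C^2 are
  convergent double power series, given by their coefficients c i j (coefficient of x^i y^j).\<close>

definition conv2 :: "(nat \<Rightarrow> nat \<Rightarrow> complex) \<Rightarrow> bool" where
  "conv2 c \<longleftrightarrow> (\<exists>r::real. r > 0 \<and>
      (\<lambda>(i,j). norm (c i j) * r ^ (i + j)) summable_on (UNIV :: (nat \<times> nat) set))"

text \<open>f(Gamma(t)) = sum c i j t^(n i) phi(t)^j as a formal power series in t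
  (well defined since phi(0) = 0 and n >= 1: only i, j <= k contribute to t^k).\<close>
definition comp_branch :: "(nat \<Rightarrow> nat \<Rightarrow> complex) \<Rightarrow> nat \<Rightarrow> complex fps \<Rightarrow> complex fps" where
  "comp_branch c n phi =
     Abs_fps (\<lambda>k. \<Sum>i\<le>k. \<Sum>j\<le>k. c i j * fps_nth (fps_X ^ (n * i) * phi ^ j) k)"

definition value_semigroup :: "nat \<Rightarrow> complex fps \<Rightarrow> nat set" where
  "value_semigroup n phi =
     {subdegree (comp_branch c n phi) | c. conv2 c \<and> c 0 0 = 0 \<and> comp_branch c n phi \<noteq> 0}"

text \<open>Pull-back of the 1-form omega = A dx + B dy along Gamma: h(t) dt with
  h = A(Gamma) * (t^n)' + B(Gamma) * phi'.\<close>
definition pullback_form :: "(nat \<Rightarrow> nat \<Rightarrow> complex) \<Rightarrow> (nat \<Rightarrow> nat \<Rightarrow> complex)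
    \<Rightarrow> nat \<Rightarrow> complex fps \<Rightarrow> complex fps" where
  "pullback_form A B n phi =
     comp_branch A n phi * fps_deriv (fps_X ^ n) + comp_branch B n phi * fps_deriv phi"

definition differential_values :: "nat \<Rightarrow> complex fps \<Rightarrow> nat set" where
  "differential_values n phi =
     {subdegree (pullback_form A B n phi) + 1 | A B.
        conv2 A \<and> conv2 B \<and> pullback_form A B n phi \<noteq> 0}"

definition S_generates :: "nat set \<Rightarrow> nat set \<Rightarrow> nat set \<Rightarrow> bool" where
  "S_generates S Lam T \<longleftrightarrow> T \<subseteq> Lam \<and> {t + s | t s. t \<in> T \<and> s \<in> S \<union> {0}} = Lam"

definition is_S_basis :: "nat set \<Rightarrow> nat set \<Rightarrow> nat set \<Rightarrow> bool" where
  "is_S_basis S Lam T \<longleftrightarrow> S_generates S Lam T \<and> (\<forall>T'. T' \<subset> T \<longrightarrow> \<not> S_generates S Lam T')"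

fun puiseux_e :: "nat \<Rightarrow> complex fps \<Rightarrow> nat \<Rightarrow> nat" where
  "puiseux_e n phi 0 = n"
| "puiseux_e n phi (Suc j) =
     gcd (puiseux_e n phi j) (LEAST b. fps_nth phi b \<noteq> 0 \<and> \<not> puiseux_e n phi j dvd b)"

definition puiseux_beta :: "nat \<Rightarrow> complex fps \<Rightarrow> nat \<Rightarrow> nat" where
  "puiseux_beta n phi j = (LEAST b. fps_nth phi b \<noteq> 0 \<and> \<not> puiseux_e n phi (j - 1) dvd b)"

text \<open>Genus g: number of characteristic exponents, i.e. least j with e_j = 1.\<close>
definition puiseux_genus :: "nat \<Rightarrow> complex fps \<Rightarrow> nat" where
  "puiseux_genus n phi = (LEAST j. puiseux_e n phi j = 1)"

definition puiseux_n :: "nat \<Rightarrow> complex fps \<Rightarrow> nat \<Rightarrow> nat" where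
  "puiseux_n n phi j = puiseux_e n phi (j - 1) div puiseux_e n phi j"

text \<open>betabar_1 = beta_1, betabar_(j+1) = n_j betabar_j - beta_j + beta_(j+1)
  (written as n_j betabar_j + beta_(j+1) - beta_j, same value since beta_(j+1) > beta_j).
  Index 0 is unused.\<close>
fun puiseux_betabar :: "nat \<Rightarrow> complex fps \<Rightarrow> nat \<Rightarrow> nat" where
  "puiseux_betabar n phi 0 = 0"
| "puiseux_betabar n phi (Suc 0) = puiseux_beta n phi 1"
| "puiseux_betabar n phi (Suc (Suc j)) =
     puiseux_n n phi (Suc j) * puiseux_betabar n phi (Suc j)
       + puiseux_beta n phi (Suc (Suc j)) - puiseux_beta n phi (Suc j)"

end

theory Submission
  imports Defs "HOL-Computational_Algebra.Computational_Algebra"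
begin

text \<open>
  Write \<open>\<phi>\<close> for the series of the branch. All values of forms are at least \<open>n\<close> and all elements of the
  semigroup are positive, so the point is that \<open>\<beta>\<close>-bar at level \<open>j\<close> is not \<open>\<lambda> + s\<close> with \<open>\<lambda>\<close> the
  value of a form \<open>A dx + B dy\<close> and \<open>s > 0\<close> the value of a function \<open>g\<close>. Truncate \<open>\<phi>\<close> below
  \<open>\<beta>\<close> at level \<open>j\<close>, let \<open>\<psi>\<^sub>\<tau>\<close> be the conjugates of the truncation \<open>\<psi>\<close> under \<open>t \<mapsto> \<zeta>\<^sup>\<tau> t\<close>, and
  \<open>F = \<Prod> (y - \<psi>\<^sub>\<tau>)\<close>; then \<open>F(\<phi>)\<close> has order \<open>\<beta>\<close>-bar, the sum of all contact orders \<open>c\<^sub>\<tau>\<close>.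

  Lagrange interpolation at the \<open>\<psi>\<^sub>\<tau>\<close> expresses the form along \<open>\<phi>\<close> through its data along the
  \<open>\<psi>\<^sub>\<tau>\<close>, modulo order \<open>\<beta>\<close>-bar. Its first exponent not divisible by \<open>e = gcd(n, \<beta>\<^sub>1, \<dots>)\<close> of the
  previous level comes with the factor \<open>\<Sum> c\<^sub>\<tau> \<omega>\<^sup>\<tau>\<close>, \<open>\<omega>\<close> a root of unity, which is a positive
  integer. As \<open>s\<close> is divisible by \<open>e\<close> and \<open>\<beta>\<close>-bar is not, this forces \<open>B(\<psi>)\<close> to have
  order \<open>ord F'(\<psi>) - s\<close> and the form to vanish along \<open>\<psi>\<close> to order greater than \<open>\<lambda>\<close>. Then
  \<open>K = B g\<^sub>x - A g\<^sub>y\<close> has order \<open>ord F'(\<psi>) - n\<close> along \<open>\<psi>\<close>, so the trace \<open>\<Sum> K(\<psi>\<^sub>\<tau>) / F'(\<psi>\<^sub>\<tau>)\<close> has a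
  pole of order \<open>n\<close>; but it is a coefficient of the remainder of \<open>K\<close> modulo \<open>F\<close>, hence a power series.
\<close>

section \<open>Leading terms of Laurent series\<close>

text \<open>\<open>lead k c x\<close> says \<open>x = c t\<^sup>k + higher terms\<close>; the value \<open>c = 0\<close> is allowed and means order
  greater than \<open>k\<close>.\<close>

definition lead :: "int \<Rightarrow> 'a::field \<Rightarrow> 'a fls \<Rightarrow> bool" where
  "lead k c x \<longleftrightarrow> (\<exists>p. fps_nth p 0 = c \<and> x = fls_shift (-k) (fps_to_fls p))"

lemma lead_nth: "lead k c x \<longleftrightarrow> (\<forall>i<k. fls_nth x i = 0) \<and> fls_nth x k = c"
proof
  assume "lead k c x"
  then show "(\<forall>i<k. fls_nth x i = 0) \<and> fls_nth x k = c"
    by (auto simp: lead_def)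
next
  assume *: "(\<forall>i<k. fls_nth x i = 0) \<and> fls_nth x k = c"
  have "x = fls_shift (-k) (fps_to_fls (Abs_fps (\<lambda>i. fls_nth x (k + int i))))"
    by (rule fls_eqI) (use * in auto)
  with * show "lead k c x" unfolding lead_def
    by (intro exI[of _ "Abs_fps (\<lambda>i. fls_nth x (k + int i))"]) auto
qed

lemma lead_add: "lead k c x \<Longrightarrow> lead k c' y \<Longrightarrow> lead k (c + c') (x + y)"
  by (auto simp: lead_nth)

lemma lead_diff: "lead k c x \<Longrightarrow> lead k c' y \<Longrightarrow> lead k (c - c') (x - y)"
  by (auto simp: lead_nth)

lemma lead_0: "lead k 0 0"
  by (auto simp: lead_nth)

lemma lead_sum: "(\<And>i. i \<in> I \<Longrightarrow> lead k (c i) (x i)) \<Longrightarrow> lead k (\<Sum>i\<in>I. c i) (\<Sum>i\<in>I. x i)"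
  by (induction I rule: infinite_finite_induct) (auto simp: lead_0 intro: lead_add)

lemma lead_mult: "lead k c x \<Longrightarrow> lead l c' y \<Longrightarrow> lead (k + l) (c * c') (x * y)"
proof -
  assume "lead k c x" "lead l c' y"
  then obtain p q where "fps_nth p 0 = c" "x = fls_shift (-k) (fps_to_fls p)"
     "fps_nth q 0 = c'" "y = fls_shift (-l) (fps_to_fls q)" by (auto simp: lead_def)
  then show ?thesis unfolding lead_def
    by (intro exI[of _ "p * q"])
       (auto simp: fls_times_fps_to_fls fls_times_both_shifted_simp algebra_simps)
qed

lemma lead_1: "lead 0 1 1"
  by (auto simp: lead_nth)

lemma lead_prod: "(\<And>i. i \<in> I \<Longrightarrow> lead (k i) (c i) (x i)) \<Longrightarrow> lead (\<Sum>i\<in>I. k i) (\<Prod>i\<in>I. c i) (\<Prod>i\<in>I. x i)"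
  by (induction I rule: infinite_finite_induct) (auto simp: lead_1 intro: lead_mult)

lemma lead_inverse: 
  assumes "lead k c x" "c \<noteq> 0" shows "lead (-k) (1 / c) (inverse x)"
proof -
  from assms obtain p where p: "fps_nth p 0 = c" "x = fls_shift (-k) (fps_to_fls p)"
    by (auto simp: lead_def)
  define y where "y = fls_shift k (fps_to_fls (inverse p))"
  have "p * inverse p = 1" using p assms by (intro inverse_mult_eq_1') auto
  then have "x * y = 1" unfolding p y_def
    by (simp add: fls_times_both_shifted_simp flip: fls_times_fps_to_fls)
  then have "inverse x = y" by (simp add: inverse_unique)
  then show ?thesis unfolding lead_def y_def using p assms
    by (intro exI[of _ "inverse p"]) (auto simp: inverse_eq_divide)
qed

lemma lead_divide: "lead k c x \<Longrightarrow> lead l c' y \<Longrightarrow> c' \<noteq> 0 \<Longrightarrow> lead (k - l) (c / c') (x / y)"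
  using lead_mult[of k c x "-l" "1 / c'" "inverse y"] lead_inverse[of l c' y]
  by (simp add: divide_inverse)

lemma lead_weaken: "lead k c x \<Longrightarrow> l < k \<Longrightarrow> lead l 0 x"
  by (auto simp: lead_nth)

lemma lead_fps: "lead (int m) c (fps_to_fls p) \<longleftrightarrow> (\<forall>i<m. fps_nth p i = 0) \<and> fps_nth p m = c"
proof
  assume l: "lead (int m) c (fps_to_fls p)"
  have "fps_nth p i = fls_nth (fps_to_fls p) (int i)" for i by simp
  with l show "(\<forall>i<m. fps_nth p i = 0) \<and> fps_nth p m = c" unfolding lead_nth by (metis of_nat_less_iff)
next
  assume "(\<forall>i<m. fps_nth p i = 0) \<and> fps_nth p m = c"
  then show "lead (int m) c (fps_to_fls p)" by (auto simp: lead_nth)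
qed

lemma lead_fps_0: "lead 0 (fps_nth p 0) (fps_to_fls p)"
  using lead_fps[of 0 "fps_nth p 0" p] by simp

lemma lead_nonzero: "lead k c x \<Longrightarrow> c \<noteq> 0 \<Longrightarrow> x \<noteq> 0"
  by (auto simp: lead_nth)

lemma lead_unique: "lead k c x \<Longrightarrow> lead l c' x \<Longrightarrow> c \<noteq> 0 \<Longrightarrow> c' \<noteq> 0 \<Longrightarrow> k = l"
  by (auto simp: lead_nth) (metis linorder_neqE)

section \<open>Substitutions t -> z t, the Euler derivation, and series in a power of t\<close>

definition rot :: "complex \<Rightarrow> complex fps \<Rightarrow> complex fps" where
  "rot z p = p oo (fps_const z * fps_X)"

lemma rot_nth: "fps_nth (rot z p) k = z ^ k * fps_nth p k"
  by (simp add: rot_def fps_compose_linear)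

lemma rot_hom: "rot z (p + q) = rot z p + rot z q" "rot z (p - q) = rot z p - rot z q"
   "rot z (p * q) = rot z p * rot z q" "rot z 0 = 0" "rot z 1 = 1"
  by (simp_all add: rot_def fps_compose_add_distrib fps_compose_sub_distrib fps_compose_mult_distrib)

lemma rot_rot: "rot z (rot y p) = rot (z * y) p"
  by (simp add: fps_eq_iff rot_nth power_mult_distrib mult_ac)

lemma rot_one: "rot 1 p = p"
  by (simp add: fps_eq_iff rot_nth)

lemma lead_rot: "lead (int m) c (fps_to_fls p) \<Longrightarrow> lead (int m) (z ^ m * c) (fps_to_fls (rot z p))"
  by (simp add: lead_fps rot_nth)

text \<open>The Euler derivation t d/dt. It keeps every exponent in place, so supports and positive
  orders survive it, and it commutes with \<open>rot\<close>.\<close>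

definition theta :: "complex fps \<Rightarrow> complex fps" where
  "theta p = fps_X * fps_deriv p"

lemma theta_nth: "fps_nth (theta p) k = of_nat k * fps_nth p k"
  by (cases k) (auto simp: theta_def)

lemma theta_add: "theta (p + q) = theta p + theta q"
  and theta_diff: "theta (p - q) = theta p - theta q"
  and theta_mult: "theta (p * q) = theta p * q + p * theta q"
  by (simp_all add: theta_def algebra_simps)

lemma theta_rot: "theta (rot z p) = rot z (theta p)"
  by (simp add: fps_eq_iff rot_nth theta_nth)

lemma lead_theta: "lead (int m) c (fps_to_fls p) \<Longrightarrow> lead (int m) (of_nat m * c) (fps_to_fls (theta p))"
  by (simp add: lead_fps theta_nth)

definition supp_dvd :: "nat \<Rightarrow> complex fps \<Rightarrow> bool" where
  "supp_dvd n p \<longleftrightarrow> (\<forall>k. fps_nth p k \<noteq> 0 \<longrightarrow> n dvd k)"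

lemma supp_dvd_add: "supp_dvd n p \<Longrightarrow> supp_dvd n q \<Longrightarrow> supp_dvd n (p + q)"
  by (force simp: supp_dvd_def)

lemma supp_dvd_mult: "supp_dvd n p \<Longrightarrow> supp_dvd n q \<Longrightarrow> supp_dvd n (p * q)"
  unfolding supp_dvd_def
proof (intro allI impI)
  fix k assume a: "\<forall>k. fps_nth p k \<noteq> 0 \<longrightarrow> n dvd k" "\<forall>k. fps_nth q k \<noteq> 0 \<longrightarrow> n dvd k"
    "fps_nth (p * q) k \<noteq> 0"
  then have "(\<Sum>i=0..k. fps_nth p i * fps_nth q (k - i)) \<noteq> 0" by (simp add: fps_mult_nth)
  then obtain i where i: "i \<in> {0..k}" "fps_nth p i * fps_nth q (k - i) \<noteq> 0"
    by (meson sum.not_neutral_contains_not_neutral)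
  then have "n dvd i" "n dvd (k - i)" using a by auto
  then show "n dvd k" using i by (metis atLeastAtMost_iff dvd_add le_add_diff_inverse)
qed

lemma supp_dvd_mono: "supp_dvd n p \<Longrightarrow> e dvd n \<Longrightarrow> supp_dvd e p"
  by (meson supp_dvd_def dvd_trans)

lemma rot_supp_dvd: "supp_dvd n p \<Longrightarrow> z ^ n = 1 \<Longrightarrow> rot z p = p"
proof -
  assume *: "supp_dvd n p" "z ^ n = 1"
  have "z ^ k * fps_nth p k = fps_nth p k" for k
    using * by (cases "fps_nth p k = 0") (auto simp: supp_dvd_def power_mult elim!: dvdE)
  then show ?thesis by (simp add: fps_eq_iff rot_nth)
qed

text \<open>With x = t^n these are the polynomials in y over the power series in x.\<close>

definition psupp_dvd :: "nat \<Rightarrow> complex fps poly \<Rightarrow> bool" where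
  "psupp_dvd n P \<longleftrightarrow> (\<forall>i. supp_dvd n (coeff P i))"

lemma psupp_dvd_pCons: "psupp_dvd n (pCons a P) \<longleftrightarrow> supp_dvd n a \<and> psupp_dvd n P"
  by (auto simp: psupp_dvd_def coeff_pCons split: nat.splits) 

lemma psupp_dvd_pderiv: "psupp_dvd n P \<Longrightarrow> psupp_dvd n (pderiv P)"
  unfolding psupp_dvd_def
proof 
  fix i assume "\<forall>i. supp_dvd n (coeff P i)"
  moreover have "supp_dvd n (of_nat k)" for k
    by (auto simp: supp_dvd_def fps_of_nat[symmetric] simp del: fps_of_nat)
  ultimately show "supp_dvd n (coeff (pderiv P) i)" unfolding coeff_pderiv
    by (intro supp_dvd_mult) (blast+)
qed

text \<open>The coefficients are fixed by an n-th root of unity and \<open>rot\<close> is a ring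
  homomorphism, so values at conjugate points are conjugate.\<close>

lemma poly_rot:
  assumes "psupp_dvd n P" "z ^ n = 1"
  shows "poly P (rot z x) = rot z (poly P x)"
  using assms(1)
  by (induction P) (auto simp: psupp_dvd_pCons rot_hom rot_supp_dvd[OF _ assms(2)])

lemma supp_dvd_poly:
  assumes "psupp_dvd n P" "e dvd n" "supp_dvd e x"
  shows "supp_dvd e (poly P x)"
  using assms(1)
proof (induction P)
  case 0 then show ?case by (simp add: supp_dvd_def)
next
  case (pCons a P)
  then show ?case using assms(2,3)
    by (auto simp: psupp_dvd_pCons intro!: supp_dvd_add supp_dvd_mult intro: supp_dvd_mono)
qed

section \<open>Division by a monic polynomial and Lagrange interpolation\<close>

lemma division_monic:
  fixes T f :: "'a::idom poly"
  assumes "lead_coeff f = 1" "degree f > 0"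
  obtains T0 T1 where "T = T0 + f * T1" "degree T0 < degree f"
proof -
  obtain q r where "pseudo_divmod T f = (q, r)" by fastforce
  moreover have "f \<noteq> 0" using assms by auto
  ultimately have "T = r + f * q" "r = 0 \<or> degree r < degree f"
    using pseudo_divmod[of f T q r] assms by auto
  with that assms show ?thesis by (metis degree_0)
qed

text \<open>Both sides have degree below \<open>card I\<close> and agree at \<open>card I\<close>
  points; a nonzero difference would have too many roots.\<close>

lemma lagrange_interpolation:
  fixes x :: "nat \<Rightarrow> 'a::field" and T :: "'a poly"
  assumes inj: "inj_on x I" and fin: "finite I" and deg: "degree T < card I"
  shows "T = (\<Sum>i\<in>I. smult (poly T (x i) / (\<Prod>k\<in>I-{i}. x i - x k)) (\<Prod>k\<in>I-{i}. [:- x k, 1:]))"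
    (is "T = ?R")
proof (rule ccontr)
  assume ne: "T \<noteq> ?R"
  have ev: "poly ?R (x i) = poly T (x i)" if i: "i \<in> I" for i
  proof -
    have "poly ?R (x i) = (\<Sum>m\<in>I. poly T (x m) / (\<Prod>k\<in>I-{m}. x m - x k) * (\<Prod>k\<in>I-{m}. x i - x k))"
      by (simp add: poly_sum poly_prod)
    also have "\<dots> = (\<Sum>m\<in>I. if m = i then poly T (x i) else 0)"
    proof (rule sum.cong[OF refl])
      fix m assume m: "m \<in> I"
      show "poly T (x m) / (\<Prod>k\<in>I-{m}. x m - x k) * (\<Prod>k\<in>I-{m}. x i - x k) = (if m = i then poly T (x i) else 0)"
      proof (cases "m = i")
        case True
        have "(\<Prod>k\<in>I-{i}. x i - x k) \<noteq> 0" using inj i fin by (auto simp: inj_on_def)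
        then show ?thesis using True by simp
      next
        case False
        then have "(\<Prod>k\<in>I-{m}. x i - x k) = 0" using i fin by (intro prod_zero) auto
        then show ?thesis using False by simp
      qed
    qed
    also have "\<dots> = poly T (x i)" using i fin by simp
    finally show ?thesis .
  qed
  have dR: "degree ?R \<le> card I - 1"
  proof (rule degree_sum_le[OF fin])
    fix i assume i: "i \<in> I"
    have "degree (\<Prod>k\<in>I-{i}. [:- x k, 1:]) \<le> (\<Sum>k\<in>I-{i}. degree [:- x k, 1:])"
      using degree_prod_sum_le[of "I-{i}" "\<lambda>k. [:- x k, 1:]"] fin by (simp add: o_def)
    also have "\<dots> = card I - 1" using i fin by simp
    finally show "degree (smult (poly T (x i) / (\<Prod>k\<in>I-{i}. x i - x k)) (\<Prod>k\<in>I-{i}. [:- x k, 1:])) \<le> card I - 1"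
      using degree_smult_le le_trans by blast
  qed
  have "degree (T - ?R) < card I"
    using dR deg by (intro degree_diff_less) auto
  moreover have "card I = card (x ` I)" using inj by (simp add: card_image)
  moreover have "card (x ` I) \<le> card {z. poly (T - ?R) z = 0}"
    using ne ev by (intro card_mono poly_roots_finite) auto
  moreover have "card {z. poly (T - ?R) z = 0} \<le> degree (T - ?R)"
    using ne by (intro card_poly_roots_bound) auto
  ultimately show False by linarith
qed

text \<open>Interpolation divides by differences of nodes, so it takes place in the field of Laurent
  series.\<close>

abbreviation hat :: "complex fps \<Rightarrow> complex fls" where "hat \<equiv> fps_to_fls"

lemma hat_mult: "hat (p * q) = hat p * hat q" by (rule fls_times_fps_to_fls)
lemma hat_add: "hat (p + q) = hat p + hat q" by simp 
lemma hat_diff: "hat (p - q) = hat p - hat q" by simp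

declare fps_to_fls_plus [simp del] fps_to_fls_minus [simp del]

lemma hat_0: "hat 0 = 0" by simp
lemma hat_prod: "hat (\<Prod>i\<in>I. g i) = (\<Prod>i\<in>I. hat (g i))"
  by (induction I rule: infinite_finite_induct) (auto simp: hat_mult)

lemma hat_of_nat: "hat (of_nat k) = of_nat k"
  by (induction k) (auto simp: hat_add)

lemma poly_hat: "poly (map_poly hat P) (hat x) = hat (poly P x)"
  by (induction P) (auto simp: map_poly_pCons hat_mult hat_add)

lemma pderiv_hat: "pderiv (map_poly hat P) = map_poly hat (pderiv P)"
  by (rule poly_eqI) (simp only: coeff_pderiv coeff_map_poly[where f = hat, OF hat_0] hat_mult hat_of_nat)

lemma coeff_prod_linear: "finite J \<Longrightarrow> coeff (\<Prod>k\<in>J. [:- x k, 1:]) (card J) = (1::'a::idom)"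
proof -
  assume J: "finite J"
  have "degree (\<Prod>k\<in>J. [:- x k, 1:]) = (\<Sum>k\<in>J. degree [:- x k, 1:])"
    by (rule degree_prod_eq_sum_degree) auto
  then have "degree (\<Prod>k\<in>J. [:- x k, 1:]) = card J" by simp
  moreover have "lead_coeff (\<Prod>k\<in>J. [:- x k, 1:]) = 1" by (simp add: lead_coeff_prod)
  ultimately show ?thesis by simp
qed

lemma degree_prod_linear: "degree (\<Prod>k\<in>J. [:- x k, 1:]) = card J" for x :: "_ \<Rightarrow> 'a::idom"
proof -
  have "degree (\<Prod>k\<in>J. [:- x k, 1:]) = (\<Sum>k\<in>J. degree [:- x k, 1:])"
    by (rule degree_prod_eq_sum_degree) auto
  then show ?thesis by simp
qed

lemma poly_pderiv_prod_root:
  fixes x :: "nat \<Rightarrow> 'a::idom"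
  assumes "finite I" "i \<in> I"
  shows "poly (pderiv (\<Prod>k\<in>I. [:- x k, 1:])) (x i) = (\<Prod>k\<in>I-{i}. x i - x k)"
proof -
  have "poly (pderiv (\<Prod>k\<in>I. [:- x k, 1:])) (x i) = (\<Sum>m\<in>I. (\<Prod>k\<in>I-{m}. x i - x k))"
    by (simp add: pderiv_prod poly_sum poly_prod pderiv_pCons)
  also have "\<dots> = (\<Sum>m\<in>I. if m = i then (\<Prod>k\<in>I-{i}. x i - x k) else 0)"
    using assms by (intro sum.cong) (auto intro!: prod_zero)
  also have "\<dots> = (\<Prod>k\<in>I-{i}. x i - x k)" using assms by simp
  finally show ?thesis .
qed

lemma coeff_prod_linear_rot:
  "coeff (\<Prod>k\<in>I. [:- rot z (x k), 1:]) i = rot z (coeff (\<Prod>k\<in>I. [:- x k, 1:]) i)"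
proof (induction I arbitrary: i rule: infinite_finite_induct)
  case (insert a I)
  have *: "coeff ([:- u, 1:] * P) i = coeff (pCons 0 P) i - u * coeff P i" for u :: "complex fps" and P i
    by (simp add: mult_pCons_left)
  show ?case unfolding prod.insert[OF insert(1,2)] *
    by (simp add: insert coeff_pCons rot_hom split: nat.splits)
qed (auto simp: rot_hom one_pCons coeff_pCons split: nat.splits)

lemma lead_subdegree: "x \<noteq> 0 \<Longrightarrow> lead (int (subdegree x)) (fps_nth x (subdegree x)) (hat x)"
  by (auto simp: lead_fps)

lemma lead_below: "x = 0 \<or> p < subdegree x \<Longrightarrow> lead (int p) 0 (hat x)"
  unfolding lead_fps by (metis fps_zero_nth less_trans nth_less_subdegree_zero)

lemma pderiv_sum: "pderiv (\<Sum>i\<in>I. g i) = (\<Sum>i\<in>I. pderiv (g i))"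
  by (induction I rule: infinite_finite_induct) (auto simp: pderiv_add)

text \<open>Chain rule: \<open>map_poly theta\<close> differentiates the coefficients,
  \<open>pderiv\<close> the variable y.\<close>

lemma theta_poly: "theta (poly P y) = poly (map_poly theta P) y + poly (pderiv P) y * theta y"
proof (induction P)
  case 0 then show ?case by (simp add: theta_def)
next
  case (pCons a P)
  have "theta 0 = 0" by (simp add: theta_def)
  then show ?case
    by (simp add: pCons.IH map_poly_pCons pderiv_pCons theta_add theta_mult algebra_simps)
qed

text \<open>\<open>Px\<close> is the partial derivative of P by x = t^n: on series in x,
  \<open>theta\<close> is \<open>theta (fps_X ^ n)\<close> times d/dx.\<close>

lemma theta_div_X_power:
  assumes "psupp_dvd n P" "n > 0"
  obtains Px where "smult (theta (fps_X ^ n)) Px = map_poly theta P" "psupp_dvd n Px"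
proof
  define h where "h p = fps_const (1 / of_nat n) * fps_shift n (theta p)" for p
  have h0: "h 0 = 0" "theta 0 = 0" by (simp_all add: h_def theta_def)
  have "supp_dvd n (h p)" if "supp_dvd n p" for p
    using that by (auto simp: supp_dvd_def h_def theta_nth)
  then show "psupp_dvd n (map_poly h P)"
    using assms(1) by (simp add: psupp_dvd_def coeff_map_poly h0)
  show "smult (theta (fps_X ^ n)) (map_poly h P) = map_poly theta P"
  proof (rule poly_eqI)
    fix i
    define p where "p = coeff P i"
    have p: "supp_dvd n p" using assms(1) by (simp add: p_def psupp_dvd_def)
    have t: "theta (fps_X ^ n) = fps_const (of_nat n) * fps_X ^ n"
      by (simp add: fps_eq_iff theta_nth)
    have "theta (fps_X ^ n) * h p = fps_const (of_nat n * (1 / of_nat n)) * (fps_X ^ n * fps_shift n (theta p))"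
      unfolding t h_def fps_const_mult[symmetric] by (simp only: mult_ac)
    also have "\<dots> = fps_X ^ n * fps_shift n (theta p)" using assms(2) by simp
    also have "\<dots> = theta p"
    proof -
      \<comment> \<open>Dividing by t^n loses nothing: below exponent n only a constant term is
        possible, and \<open>theta\<close> kills it.\<close>
      have "fps_nth p k = 0 \<or> k = 0" if "k < n" for k
        using p that nat_dvd_not_less[of k n] by (auto simp: supp_dvd_def)
      then show ?thesis by (auto simp: fps_eq_iff fps_X_power_mult_nth theta_nth)
    qed
    finally show "coeff (smult (theta (fps_X ^ n)) (map_poly h P)) i = coeff (map_poly theta P) i"
      by (simp add: coeff_map_poly h0 p_def)
  qed
qed

section \<open>Interpolation on the conjugates of a truncated branch\<close>

text \<open>\<open>\<psi>\<close> is the truncation of \<open>\<phi>\<close> below the characteristic exponent \<open>\<beta>\<close>. For \<open>\<tau> > 0\<close>, \<open>c \<tau>\<close> is the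
  order of contact of \<open>\<psi>\<close> with its conjugate \<open>\<psi>(\<zeta>\<^sup>\<tau> t)\<close>; \<open>c 0\<close> is that of \<open>\<phi>\<close> with \<open>\<psi>\<close>.\<close>

locale branch_level =
  fixes n d e \<beta> :: nat and \<zeta> :: complex and c :: "nat \<Rightarrow> nat" and \<phi> \<psi> :: "complex fps"
  assumes n: "n = d * e" "n > 0"
    and zeta: "\<And>k. \<zeta> ^ k = 1 \<longleftrightarrow> n dvd k"
    and psi: "supp_dvd e \<psi>"
    and phi_psi: "\<And>i. i < \<beta> \<Longrightarrow> fps_nth \<phi> i = fps_nth \<psi> i" "fps_nth \<phi> \<beta> \<noteq> fps_nth \<psi> \<beta>"
    and beta: "\<not> e dvd \<beta>"
    and c_0: "c 0 = \<beta>"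
    and c_less: "\<And>\<tau>. 0 < \<tau> \<Longrightarrow> \<tau> < d \<Longrightarrow> c \<tau> < \<beta>"
    and c_below: "\<And>\<tau> i. 0 < \<tau> \<Longrightarrow> \<tau> < d \<Longrightarrow> i < c \<tau> \<Longrightarrow> fps_nth \<psi> i \<noteq> 0 \<Longrightarrow> \<zeta> ^ (\<tau> * i) = 1"
    and c_at: "\<And>\<tau>. 0 < \<tau> \<Longrightarrow> \<tau> < d \<Longrightarrow> fps_nth \<psi> (c \<tau>) \<noteq> 0 \<and> \<zeta> ^ (\<tau> * c \<tau>) \<noteq> 1"
    and positivity: "\<And>\<omega>. \<omega> ^ d = 1 \<Longrightarrow> (\<Sum>\<tau><d. of_nat (c \<tau>) * \<omega> ^ \<tau>) \<noteq> (0::complex)"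
begin

definition node :: "nat \<Rightarrow> complex fps" where "node \<tau> = rot (\<zeta> ^ \<tau>) \<psi>"
definition semiroot :: "complex fps poly" where "semiroot = (\<Prod>\<tau><d. [:- node \<tau>, 1:])"
text \<open>The order of \<open>semiroot\<close> along \<phi>, later identified with
  \<open>\<beta>\<close>-bar; \<open>D\<close> is the order along \<psi> of its derivative in
  y.\<close>

definition total :: nat where "total = (\<Sum>\<tau><d. c \<tau>)"
definition D :: nat where "D = (\<Sum>\<tau>\<in>{..<d}-{0}. c \<tau>)"
text \<open>The leading coefficient of \<open>\<phi> - node \<tau>\<close>, and for positive \<tau>
  also that of \<open>\<psi> - node \<tau>\<close>.\<close>

definition \<gamma> :: "nat \<Rightarrow> complex" where
  "\<gamma> \<tau> = (if \<tau> = 0 then fps_nth \<phi> \<beta> - fps_nth \<psi> \<beta> else fps_nth \<psi> (c \<tau>) * (1 - \<zeta> ^ (\<tau> * c \<tau>)))"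
text \<open>The y-derivative of \<open>semiroot\<close> at \<open>node \<tau>\<close>, as a product;
  \<open>\<Gamma>\<close> is its leading coefficient for \<tau> = 0.\<close>

definition node_diff :: "nat \<Rightarrow> complex fps" where "node_diff \<tau> = (\<Prod>k\<in>{..<d}-{\<tau>}. node \<tau> - node k)"
definition \<Gamma> :: complex where "\<Gamma> = (\<Prod>k\<in>{..<d}-{0}. \<gamma> k)"

lemma d_pos: "d > 0"
  using n by auto

lemma zeta_root: "(\<zeta> ^ \<tau>) ^ n = 1"
  by (metis dvd_triv_right power_mult zeta)

lemma zeta_nz: "\<zeta> \<noteq> 0"
  using zeta[of n] n by (auto simp: power_0_left)

lemma node_0: "node 0 = \<psi>" by (simp add: node_def rot_one)

lemma total_eq: "total = \<beta> + D"
  unfolding total_def D_def using d_pos c_0 by (subst sum.remove[of _ 0]) auto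

text \<open>Each \<open>c \<tau>\<close> with \<tau> positive is an exponent occurring in \<psi>, a
  series in t^e.\<close>

lemma e_dvd_D: "e dvd D"
  unfolding D_def using c_at psi by (intro dvd_sum) (auto simp: supp_dvd_def)

lemma not_e_dvd_total: "\<not> e dvd total"
  using e_dvd_D beta total_eq dvd_add_left_iff by metis

lemma \<gamma>_nz: "\<tau> < d \<Longrightarrow> \<gamma> \<tau> \<noteq> 0"
  using c_at[of \<tau>] phi_psi(2) by (auto simp: \<gamma>_def)

lemma \<Gamma>_nz: "\<Gamma> \<noteq> 0"
  using \<gamma>_nz by (auto simp: \<Gamma>_def)

lemma lead_psi_node: "0 < \<tau> \<Longrightarrow> \<tau> < d \<Longrightarrow> lead (int (c \<tau>)) (\<gamma> \<tau>) (hat (\<psi> - node \<tau>))"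
  using c_below[of \<tau>]
  by (fastforce simp: lead_fps \<gamma>_def node_def rot_nth algebra_simps power_mult[symmetric])

lemma lead_phi_node: "\<tau> < d \<Longrightarrow> lead (int (c \<tau>)) (\<gamma> \<tau>) (hat (\<phi> - node \<tau>))"
proof (cases "\<tau> = 0")
  case True
  then show ?thesis using phi_psi c_0 by (auto simp: lead_fps \<gamma>_def node_0)
next
  case False
  assume "\<tau> < d"
  \<comment> \<open>\<open>\<phi> - \<psi>\<close> starts at \<beta>, beyond the contact order of
    \<psi> with its conjugates, so replacing \<psi> by \<phi> keeps the leading term.\<close>
  then have "lead (int (c \<tau>)) 0 (hat (\<phi> - \<psi>))" using phi_psi(1) c_less[of \<tau>] False
    by (auto simp: lead_fps)
  from lead_add[OF this lead_psi_node[of \<tau>]] False \<open>\<tau> < d\<close> show ?thesis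
    by (simp flip: hat_add)
qed

text \<open>The substitution t -> \<zeta> t permutes the nodes cyclically, since
  \<open>node d = node 0\<close>. Hence it fixes the coefficients of the product, and a series fixed
  by it is a series in t^n.\<close>

lemma semiroot_psupp: "psupp_dvd n semiroot"
proof -
  have "node d = node 0"
    unfolding node_0 unfolding node_def by (rule rot_supp_dvd[OF psi]) (metis n(1) dvd_refl power_mult zeta)
  have *: "(\<Prod>\<tau><d. [:- node (Suc \<tau>), 1:]) = semiroot"
  proof -
    obtain m where m: "d = Suc m" using d_pos gr0_conv_Suc by blast
    have "(\<Prod>\<tau><d. [:- node (Suc \<tau>), 1:]) = (\<Prod>\<tau><m. [:- node (Suc \<tau>), 1:]) * [:- node d, 1:]"
      unfolding m by simp
    also have "\<dots> = [:- node 0, 1:] * (\<Prod>\<tau><m. [:- node (Suc \<tau>), 1:])" by (simp add: \<open>node d = node 0\<close>)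
    also have "\<dots> = (\<Prod>\<tau><Suc m. [:- node \<tau>, 1:])" by (simp only: prod.lessThan_Suc_shift)
    finally show ?thesis unfolding semiroot_def unfolding m .
  qed
  have inv: "rot \<zeta> (coeff semiroot i) = coeff semiroot i" for i
  proof -
    have "rot \<zeta> (coeff semiroot i) = coeff (\<Prod>\<tau><d. [:- rot \<zeta> (node \<tau>), 1:]) i"
      unfolding semiroot_def coeff_prod_linear_rot ..
    also have "(\<lambda>\<tau>. rot \<zeta> (node \<tau>)) = (\<lambda>\<tau>. node (Suc \<tau>))" by (simp add: node_def rot_rot)
    then have "(\<Prod>\<tau><d. [:- rot \<zeta> (node \<tau>), 1:]) = (\<Prod>\<tau><d. [:- node (Suc \<tau>), 1:])" by metis
    finally show ?thesis by (simp only: *)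
  qed
  show ?thesis unfolding psupp_dvd_def supp_dvd_def
  proof (intro allI impI)
    fix i k assume k: "fps_nth (coeff semiroot i) k \<noteq> 0"
    have "\<zeta> ^ k * fps_nth (coeff semiroot i) k = fps_nth (coeff semiroot i) k"
      using inv[of i] by (metis rot_nth)
    then show "n dvd k" using k by (simp add: zeta)
  qed
qed

lemma poly_node: "psupp_dvd n P \<Longrightarrow> poly P (node \<tau>) = rot (\<zeta> ^ \<tau>) (poly P \<psi>)"
  unfolding node_def by (rule poly_rot[OF _ zeta_root])

lemma lead_node_diff_0: "lead (int D) \<Gamma> (hat (node_diff 0))"
  unfolding node_diff_def hat_prod D_def \<Gamma>_def of_nat_sum node_0
  by (rule lead_prod) (auto intro: lead_psi_node)

text \<open>The derivative of \<open>semiroot\<close> again has coefficients in t^n, so its values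
  at the nodes are conjugate.\<close>

lemma node_diff_rot: "\<tau> < d \<Longrightarrow> node_diff \<tau> = rot (\<zeta> ^ \<tau>) (node_diff 0)"
proof -
  have *: "\<tau> < d \<Longrightarrow> node_diff \<tau> = poly (pderiv semiroot) (node \<tau>)" for \<tau>
    unfolding node_diff_def semiroot_def by (subst poly_pderiv_prod_root) auto
  show "\<tau> < d \<Longrightarrow> node_diff \<tau> = rot (\<zeta> ^ \<tau>) (node_diff 0)"
    using d_pos by (simp add: * poly_node[OF psupp_dvd_pderiv[OF semiroot_psupp]] node_0)
qed

lemma lead_node_diff: "\<tau> < d \<Longrightarrow> lead (int D) ((\<zeta> ^ \<tau>) ^ D * \<Gamma>) (hat (node_diff \<tau>))"
  by (subst node_diff_rot) (auto intro: lead_rot[OF lead_node_diff_0])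

lemma node_diff_coeff_nz: "(\<zeta> ^ \<tau>) ^ D * \<Gamma> \<noteq> 0"
  using \<Gamma>_nz zeta_nz by auto

lemma node_diff_nz: "\<tau> < d \<Longrightarrow> node_diff \<tau> \<noteq> 0"
  using lead_nonzero[OF lead_node_diff[of \<tau>] node_diff_coeff_nz] by auto

lemma node_inj: "inj_on node {..<d}"
proof (rule inj_onI, rule ccontr)
  fix x y assume xy: "x \<in> {..<d}" "y \<in> {..<d}" "node x = node y" "x \<noteq> y"
  then have "node_diff x = 0" unfolding node_diff_def by (intro prod_zero) (auto intro!: bexI[of _ y])
  with node_diff_nz[of x] xy show False by auto
qed

text \<open>\<open>T0\<close> is the remainder of T modulo \<open>semiroot\<close>. It takes the
  values of T at the nodes, so Lagrange's formula recovers it; its coefficients are power series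
  although the single summands are Laurent series.\<close>

lemma interpolation:
  obtains T0 T1 where "T = T0 + semiroot * T1" 
    "map_poly hat T0 = (\<Sum>\<tau><d. smult (hat (poly T (node \<tau>)) / hat (node_diff \<tau>)) (\<Prod>k\<in>{..<d}-{\<tau>}. [:- hat (node k), 1:]))"
proof -
  have df: "degree semiroot = d" "lead_coeff semiroot = 1"
    using coeff_prod_linear[of "{..<d}" node] unfolding semiroot_def by (simp_all add: degree_prod_linear)
  obtain T0 T1 where T: "T = T0 + semiroot * T1" "degree T0 < d"
    using division_monic[of semiroot T] df d_pos by metis
  have root: "poly semiroot (node \<tau>) = 0" if "\<tau> < d" for \<tau>
    unfolding semiroot_def using that by (auto simp: poly_prod intro!: bexI[of _ \<tau>])
  have "map_poly hat T0 = (\<Sum>\<tau><d. smult (poly (map_poly hat T0) (hat (node \<tau>)) / (\<Prod>k\<in>{..<d}-{\<tau>}. hat (node \<tau>) - hat (node k)))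
      (\<Prod>k\<in>{..<d}-{\<tau>}. [:- hat (node k), 1:]))"
  proof (rule lagrange_interpolation)
    show "inj_on (\<lambda>\<tau>. hat (node \<tau>)) {..<d}"
      using node_inj by (auto simp: inj_on_def)
    show "degree (map_poly hat T0) < card {..<d}"
      using T(2) by (simp add: degree_map_poly)
  qed simp
  also have "\<dots> = (\<Sum>\<tau><d. smult (hat (poly T (node \<tau>)) / hat (node_diff \<tau>)) (\<Prod>k\<in>{..<d}-{\<tau>}. [:- hat (node k), 1:]))"
    by (intro sum.cong) (auto simp: poly_hat T(1) root node_diff_def hat_prod hat_diff)
  finally show ?thesis using T that by blast
qed

text \<open>The Lagrange basis polynomial of \<open>node \<tau>\<close>, evaluated at
  \<phi>.\<close>

definition L :: "nat \<Rightarrow> complex fls" where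
  "L \<tau> = hat (\<Prod>k\<in>{..<d}-{\<tau>}. \<phi> - node k) / hat (node_diff \<tau>)"

lemma lead_semiroot: "lead (int total) (\<gamma> 0 * \<Gamma>) (hat (poly semiroot \<phi>))"
proof -
  have "\<gamma> 0 * \<Gamma> = (\<Prod>k<d. \<gamma> k)"
    unfolding \<Gamma>_def using d_pos by (subst prod.remove[of "{..<d}" 0]) auto
  moreover have "lead (int total) (\<Prod>k<d. \<gamma> k) (hat (poly semiroot \<phi>))"
    unfolding total_def semiroot_def poly_prod hat_prod of_nat_sum
    by (rule lead_prod) (use lead_phi_node in auto)
  ultimately show ?thesis by simp
qed

text \<open>The remainder part gives the sum, and \<open>r\<close> is a multiple of
  \<open>semiroot\<close> at \<phi>. With the coefficient left open, \<open>lead\<close> only says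
  that the order is at least \<open>total\<close>.\<close>

lemma value_formula:
  obtains r where "hat (poly T \<phi>) = (\<Sum>\<tau><d. hat (poly T (node \<tau>)) * L \<tau>) + r" "\<exists>a. lead (int total) a r"
proof -
  obtain T0 T1 where T: "T = T0 + semiroot * T1" 
    "map_poly hat T0 = (\<Sum>\<tau><d. smult (hat (poly T (node \<tau>)) / hat (node_diff \<tau>)) (\<Prod>k\<in>{..<d}-{\<tau>}. [:- hat (node k), 1:]))"
    by (rule interpolation)
  have "hat (poly T \<phi>) = hat (poly T0 \<phi>) + hat (poly semiroot \<phi>) * hat (poly T1 \<phi>)"
    by (subst T(1)) (simp add: hat_add hat_mult)
  also have "hat (poly T0 \<phi>) = poly (map_poly hat T0) (hat \<phi>)" by (simp add: poly_hat)
  also have "\<dots> = (\<Sum>\<tau><d. hat (poly T (node \<tau>)) * L \<tau>)"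
    unfolding T(2) by (simp add: poly_sum poly_prod L_def hat_prod hat_diff)
  finally show ?thesis
    using that lead_mult[OF lead_semiroot lead_fps_0] by (metis add.right_neutral)
qed

text \<open>The numerator has order \<open>total - c \<tau>\<close> and the denominator order
  \<open>D = total - \<beta>\<close>. So \<open>L 0\<close> starts with 1 and every other
  \<open>L \<tau>\<close> has positive order.\<close>

lemma lead_L: 
  assumes "\<tau> < d"
  shows "lead (int \<beta> - int (c \<tau>)) (\<gamma> 0 / (\<gamma> \<tau> * (\<zeta> ^ \<tau>) ^ D)) (L \<tau>)"
proof -
  have s: "(\<Sum>k\<in>{..<d}-{\<tau>}. int (c k)) = int total - int (c \<tau>)"
    unfolding total_def using assms by (simp add: sum.remove[of "{..<d}" \<tau>])
  have p: "(\<Prod>k\<in>{..<d}-{\<tau>}. \<gamma> k) = \<gamma> 0 * \<Gamma> / \<gamma> \<tau>"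
  proof -
    have "\<gamma> 0 * \<Gamma> = (\<Prod>k<d. \<gamma> k)"
      unfolding \<Gamma>_def using d_pos by (subst prod.remove[of "{..<d}" 0]) auto
    also have "\<dots> = \<gamma> \<tau> * (\<Prod>k\<in>{..<d}-{\<tau>}. \<gamma> k)" 
      using assms by (subst prod.remove[of "{..<d}" \<tau>]) auto
    finally show ?thesis using \<gamma>_nz[OF assms] by simp
  qed
  have "lead (int total - int (c \<tau>)) (\<gamma> 0 * \<Gamma> / \<gamma> \<tau>) (hat (\<Prod>k\<in>{..<d}-{\<tau>}. \<phi> - node k))"
    unfolding s[symmetric] p[symmetric] hat_prod
    by (rule lead_prod) (use lead_phi_node in auto)
  from lead_divide[OF this lead_node_diff[OF assms] node_diff_coeff_nz]
  show ?thesis unfolding L_def using \<Gamma>_nz by (simp add: total_eq)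
qed

lemma lead_L_0: "\<tau> < d \<Longrightarrow> lead 0 (if \<tau> = 0 then 1 else 0) (L \<tau>)"
  using lead_L[of \<tau>] lead_weaken[OF lead_L[of \<tau>], of 0] \<gamma>_nz[of 0] c_0 c_less[of \<tau>]
  by (cases "\<tau> = 0") auto

text \<open>Only the summand \<tau> = 0 reaches order p.\<close>

lemma lead_sum_L:
  assumes "lead (int p) a (hat x)"
  shows "lead (int p) a (\<Sum>\<tau><d. hat (rot (\<zeta> ^ \<tau>) x) * L \<tau>)"
proof -
  have "lead (int p) (\<Sum>\<tau><d. if \<tau> = 0 then a else 0) (\<Sum>\<tau><d. hat (rot (\<zeta> ^ \<tau>) x) * L \<tau>)"
  proof (rule lead_sum)
    fix \<tau> assume "\<tau> \<in> {..<d}"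
    then have "\<tau> < d" by simp
    from lead_mult[OF lead_rot[OF assms, of "\<zeta> ^ \<tau>"] lead_L_0[OF this]]
    show "lead (int p) (if \<tau> = 0 then a else 0) (hat (rot (\<zeta> ^ \<tau>) x) * L \<tau>)"
      by (auto split: if_splits)
  qed
  then show ?thesis using d_pos by simp
qed

text \<open>Here every summand reaches the same order: \<open>c \<tau>\<close> from the difference
  cancels against \<open>\<beta> - c \<tau>\<close> from \<open>L \<tau>\<close>, and so do the
  coefficients \<open>\<gamma> \<tau>\<close>. What remains is the factor \<open>c \<tau>\<close>
  produced by \<open>theta\<close> and a power of the root of unity \<zeta>^(q - D).\<close>

lemma lead_sum_theta_L:
  assumes "lead (int q) a (hat x)"
  shows "lead (int (q + \<beta>)) (a * \<gamma> 0 * (\<Sum>\<tau><d. of_nat (c \<tau>) * (\<zeta> ^ q / \<zeta> ^ D) ^ \<tau>))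
     (\<Sum>\<tau><d. hat (rot (\<zeta> ^ \<tau>) x) * hat (theta (\<phi> - node \<tau>)) * L \<tau>)"
proof -
  have "lead (int (q + \<beta>)) (\<Sum>\<tau><d. a * \<gamma> 0 * (of_nat (c \<tau>) * (\<zeta> ^ q / \<zeta> ^ D) ^ \<tau>))
     (\<Sum>\<tau><d. hat (rot (\<zeta> ^ \<tau>) x) * hat (theta (\<phi> - node \<tau>)) * L \<tau>)"
  proof (rule lead_sum)
    fix \<tau> assume "\<tau> \<in> {..<d}"
    then have t: "\<tau> < d" by simp
    have eq: "((\<zeta> ^ \<tau>) ^ q * a) * (of_nat (c \<tau>) * \<gamma> \<tau>) * (\<gamma> 0 / (\<gamma> \<tau> * (\<zeta> ^ \<tau>) ^ D))
       = a * \<gamma> 0 * (of_nat (c \<tau>) * (\<zeta> ^ q / \<zeta> ^ D) ^ \<tau>)"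
    proof -
      have "(\<zeta> ^ q / \<zeta> ^ D) ^ \<tau> = (\<zeta> ^ \<tau>) ^ q / (\<zeta> ^ \<tau>) ^ D"
        by (simp add: power_divide mult.commute[of \<tau>] flip: power_mult)
      then show ?thesis using \<gamma>_nz[OF t] zeta_nz by simp
    qed
    from lead_mult[OF lead_mult[OF lead_rot[OF assms, of "\<zeta> ^ \<tau>"] lead_theta[OF lead_phi_node[OF t]]] lead_L[OF t]]
    show "lead (int (q + \<beta>)) (a * \<gamma> 0 * (of_nat (c \<tau>) * (\<zeta> ^ q / \<zeta> ^ D) ^ \<tau>))
           (hat (rot (\<zeta> ^ \<tau>) x) * hat (theta (\<phi> - node \<tau>)) * L \<tau>)"
      unfolding eq by simp
  qed
  then show ?thesis by (simp only: sum_distrib_left)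
qed

text \<open>By \<open>value_formula\<close> and \<open>lead_sum_L\<close>, functions of order below
  \<open>total\<close> do not distinguish \<phi> from \<psi>.\<close>

lemma value_transfer:
  assumes P: "psupp_dvd n P" and p: "p < total" and l: "lead (int p) a (hat (poly P \<psi>))"
  shows "lead (int p) a (hat (poly P \<phi>))"
proof -
  obtain r b where r: "hat (poly P \<phi>) = (\<Sum>\<tau><d. hat (poly P (node \<tau>)) * L \<tau>) + r" "lead (int total) b r"
    using value_formula[of P] by metis
  have "lead (int p) 0 r" using lead_weaken[OF r(2)] p by simp
  from lead_add[OF lead_sum_L[OF l] this] show ?thesis
    unfolding r(1) poly_node[OF P] by simp
qed


lemma subdegree_transfer:
  assumes P: "psupp_dvd n P" and nz: "poly P \<phi> \<noteq> 0" and lt: "subdegree (poly P \<phi>) < total"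
  shows "poly P \<psi> \<noteq> 0" "subdegree (poly P \<psi>) = subdegree (poly P \<phi>)"
proof -
  let ?s = "subdegree (poly P \<phi>)"
  have s: "lead (int ?s) (fps_nth (poly P \<phi>) ?s) (hat (poly P \<phi>))" by (rule lead_subdegree[OF nz])
  have no: "\<not> lead (int ?s) 0 (hat (poly P \<phi>))" using nz by (auto simp: lead_fps)
  \<comment> \<open>Otherwise the transfer would make the leading coefficient of P at \<phi>
    vanish.\<close>
  have *: "\<not> (poly P \<psi> = 0 \<or> ?s < subdegree (poly P \<psi>))"
    using no value_transfer[OF P lt lead_below] by blast
  then show nz': "poly P \<psi> \<noteq> 0" by simp
  have "lead (int (subdegree (poly P \<psi>))) (fps_nth (poly P \<psi>) (subdegree (poly P \<psi>))) (hat (poly P \<phi>))"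
    using * lt by (intro value_transfer[OF P] lead_subdegree) auto
  from lead_unique[OF this s] show "subdegree (poly P \<psi>) = ?s" using nz nz' by simp
qed

lemma e_dvd_subdegree:
  assumes "supp_dvd e x" "x \<noteq> 0" shows "e dvd subdegree x"
  using assms by (auto simp: supp_dvd_def)

section \<open>Forms along the branch and along its truncation\<close>

definition theta_xn :: "complex fps" where "theta_xn = theta (fps_X ^ n)"

lemma supp_theta_xn: "supp_dvd n theta_xn"
  by (auto simp: supp_dvd_def theta_xn_def theta_nth)

lemma lead_theta_xn: "lead (int n) (of_nat n) (hat theta_xn)"
  by (auto simp: theta_xn_def lead_fps theta_nth)

lemma theta_psi: "supp_dvd e (theta \<psi>)"
  using psi by (auto simp: supp_dvd_def theta_nth)

lemma e_dvd_n: "e dvd n" using n by simp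

text \<open>As e divides both q and D, the d-th power of the quotient is a power of \<zeta> with
  exponent divisible by n = d e.\<close>

lemma positivity': "e dvd q \<Longrightarrow> (\<Sum>\<tau><d. of_nat (c \<tau>) * (\<zeta> ^ q / \<zeta> ^ D) ^ \<tau>) \<noteq> 0"
proof (rule positivity)
  assume q: "e dvd q"
  have "(\<zeta> ^ x) ^ d = 1" if "e dvd x" for x
    using that zeta[of "x * d"] n by (auto simp: power_mult[symmetric] mult.commute)
  then show "(\<zeta> ^ q / \<zeta> ^ D) ^ d = 1" using q e_dvd_D by (simp add: power_divide)
qed

text \<open>t times the coefficient of the form A dx + B dy pulled back to \<psi>.\<close>

definition trunc_form :: "complex fps poly \<Rightarrow> complex fps poly \<Rightarrow> complex fps" where
  "trunc_form A B = theta_xn * poly A \<psi> + poly B \<psi> * theta \<psi>"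

lemma supp_trunc_form: "psupp_dvd n A \<Longrightarrow> psupp_dvd n B \<Longrightarrow> supp_dvd e (trunc_form A B)"
  unfolding trunc_form_def
  by (intro supp_dvd_add supp_dvd_mult supp_dvd_poly[OF _ e_dvd_n psi] theta_psi
       supp_dvd_mono[OF supp_theta_xn e_dvd_n])

text \<open>\<open>value_formula\<close> is applied to a polynomial T that keeps
  \<open>theta \<phi>\<close> as a coefficient. At a node, splitting \<open>theta \<phi>\<close>
  into \<open>theta (node \<tau>)\<close> and the rest separates the form along the node from a term
  with only B.\<close>

lemma form_formula:
  assumes A: "psupp_dvd n A" and B: "psupp_dvd n B"
  obtains r a where "lead (int total) a r"
   "hat (theta_xn * poly A \<phi> + poly B \<phi> * theta \<phi>) =
     (\<Sum>\<tau><d. hat (rot (\<zeta> ^ \<tau>) (trunc_form A B)) * L \<tau>)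
     + (\<Sum>\<tau><d. hat (rot (\<zeta> ^ \<tau>) (poly B \<psi>)) * hat (theta (\<phi> - node \<tau>)) * L \<tau>) + r"
proof -
  define T where "T = smult theta_xn A + smult (theta \<phi>) B"
  obtain r a where r: "hat (poly T \<phi>) = (\<Sum>\<tau><d. hat (poly T (node \<tau>)) * L \<tau>) + r" "lead (int total) a r"
    using value_formula[of T] by metis
  have T: "poly T \<phi> = theta_xn * poly A \<phi> + poly B \<phi> * theta \<phi>" by (simp add: T_def)
  have nodes: "poly T (node \<tau>) = rot (\<zeta> ^ \<tau>) (trunc_form A B) + rot (\<zeta> ^ \<tau>) (poly B \<psi>) * theta (\<phi> - node \<tau>)" for \<tau>
  proof -
    have "rot (\<zeta> ^ \<tau>) theta_xn = theta_xn" by (rule rot_supp_dvd[OF supp_theta_xn zeta_root])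
    moreover have "rot (\<zeta> ^ \<tau>) (theta \<psi>) = theta (node \<tau>)" by (simp add: theta_rot node_def)
    ultimately show ?thesis
      by (simp add: T_def trunc_form_def rot_hom poly_node[OF A] poly_node[OF B] theta_diff algebra_simps)
  qed
  have "hat (poly T (node \<tau>)) * L \<tau> = hat (rot (\<zeta> ^ \<tau>) (trunc_form A B)) * L \<tau>
      + hat (rot (\<zeta> ^ \<tau>) (poly B \<psi>)) * hat (theta (\<phi> - node \<tau>)) * L \<tau>" for \<tau>
    by (simp add: nodes hat_add hat_mult algebra_simps)
  then show ?thesis using that[of a r] r T by (simp add: sum.distrib)
qed

text \<open>In \<open>S1 + S2 + r\<close>, the sum \<open>S1\<close> starts like the form along
  \<psi>, at an exponent divisible by e, and \<open>r\<close> starts no earlier than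
  \<open>total\<close>. An order below \<open>total\<close> not divisible by e can therefore only
  come from \<open>S2\<close>, which starts at \<open>M\<close>.\<close>

lemma form_value:
  assumes A: "psupp_dvd n A" and B: "psupp_dvd n B"
    and x: "x = theta_xn * poly A \<phi> + poly B \<phi> * theta \<phi>" "x \<noteq> 0"
    and lam: "subdegree x < total" "\<not> e dvd subdegree x"
  shows "poly B \<psi> \<noteq> 0" "subdegree (poly B \<psi>) + \<beta> = subdegree x"
    "lead (int (subdegree x)) 0 (hat (trunc_form A B))"
proof -
  let ?l = "subdegree x" and ?b = "poly B \<psi>" and ?w = "trunc_form A B"
  define S1 where "S1 = (\<Sum>\<tau><d. hat (rot (\<zeta> ^ \<tau>) ?w) * L \<tau>)"
  define S2 where "S2 = (\<Sum>\<tau><d. hat (rot (\<zeta> ^ \<tau>) ?b) * hat (theta (\<phi> - node \<tau>)) * L \<tau>)"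
  obtain r a where r: "lead (int total) a r" "hat x = S1 + S2 + r"
    unfolding x(1) S1_def S2_def by (rule form_formula[OF A B])
  have S1: "lead (int p) a S1" if "lead (int p) a (hat ?w)" for p a
    unfolding S1_def by (rule lead_sum_L[OF that])
  have r0: "lead (int p) 0 r" if "p < total" for p using lead_weaken[OF r(1)] that by simp
  have lx: "lead (int ?l) (fps_nth x ?l) (hat x)" by (rule lead_subdegree[OF x(2)])
  have not0: "\<not> lead (int ?l) 0 (hat x)" using x(2) by (auto simp: lead_fps)
  have suppw: "supp_dvd e ?w" by (rule supp_trunc_form[OF A B])
  have suppb: "supp_dvd e ?b" by (rule supp_dvd_poly[OF B e_dvd_n psi])
  define M where "M = subdegree ?b + \<beta>"
  \<comment> \<open>\<open>z\<close> is the leading coefficient of \<open>S2\<close>, nonzero by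
    \<open>positivity'\<close>; if B vanishes along \<psi> it is a mere placeholder.\<close>
  obtain z where z: "z \<noteq> 0" "?b \<noteq> 0 \<Longrightarrow> lead (int M) z S2"
  proof (cases "?b = 0")
    case False
    have "lead (int M) (fps_nth ?b (subdegree ?b) * \<gamma> 0 * (\<Sum>\<tau><d. of_nat (c \<tau>) * (\<zeta> ^ subdegree ?b / \<zeta> ^ D) ^ \<tau>)) S2"
      unfolding M_def S2_def by (rule lead_sum_theta_L[OF lead_subdegree[OF False]])
    moreover have "fps_nth ?b (subdegree ?b) * \<gamma> 0 * (\<Sum>\<tau><d. of_nat (c \<tau>) * (\<zeta> ^ subdegree ?b / \<zeta> ^ D) ^ \<tau>) \<noteq> 0"
      using False \<gamma>_nz[OF d_pos] positivity'[OF e_dvd_subdegree[OF suppb False]]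
      unfolding mult_eq_0_iff nth_subdegree_zero_iff by blast
    ultimately show ?thesis by (rule that[rotated])
  qed (use that[of 1] in auto)
  have S2_0: "lead (int p) 0 S2" if "?b = 0 \<or> p < M" for p
  proof (cases "?b = 0")
    case True then show ?thesis by (simp add: S2_def rot_hom lead_0)
  next
    case False then show ?thesis using that lead_weaken[OF z(2)] by simp
  qed
  have pure: "subdegree ?w = ?l \<Longrightarrow> ?w \<noteq> 0 \<Longrightarrow> False"
    using e_dvd_subdegree[OF suppw] lam(2) by auto
  \<comment> \<open>If the form along \<psi> came before \<open>S2\<close>, it would give x its
    order, which would then be divisible by e.\<close>
  have w_first: False if "?w \<noteq> 0" "subdegree ?w \<le> ?l" "?b = 0 \<or> subdegree ?w < M"
  proof -
    let ?p = "subdegree ?w"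
    have "lead (int ?p) (fps_nth ?w ?p + 0 + 0) (hat x)" unfolding r(2)
      using that lam(1) by (intro lead_add S1 lead_subdegree S2_0 r0) auto
    from lead_unique[OF this lx] have "?p = ?l" using that x(2) by simp
    with pure that show False by blast
  qed
  have *: "?b \<noteq> 0 \<and> M \<le> ?l"
  proof (rule ccontr)
    assume "\<not> (?b \<noteq> 0 \<and> M \<le> ?l)"
    then have c: "?b = 0 \<or> ?l < M" by auto
    then have "?w = 0 \<or> ?l < subdegree ?w" using w_first by force
    then have "lead (int ?l) (0 + 0 + 0) (hat x)" unfolding r(2)
      using lam(1) c by (intro lead_add S1 lead_below S2_0 r0) auto
    with not0 show False by simp
  qed
  then show "?b \<noteq> 0" by simp
  \<comment> \<open>Hence \<open>S1\<close> and \<open>S2\<close> cannot start at the same exponent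
    and cancel.\<close>
  have "\<not> e dvd M"
    using e_dvd_subdegree[OF suppb] * beta unfolding M_def by (metis dvd_add_right_iff)
  then have "?w = 0 \<or> subdegree ?w \<noteq> M" using e_dvd_subdegree[OF suppw] by metis
  then have w: "?w = 0 \<or> M < subdegree ?w" using w_first * by fastforce
  have "lead (int M) (0 + z + 0) (hat x)" unfolding r(2)
    using lam(1) w * by (intro lead_add S1 lead_below r0 z(2)) auto
  from lead_unique[OF this lx] have "M = ?l" using z(1) x(2) by simp
  then show "subdegree ?b + \<beta> = ?l" by (simp add: M_def)
  show "lead (int ?l) 0 (hat ?w)" using w \<open>M = ?l\<close> by (intro lead_below) auto
qed

text \<open>Lagrange's formula for G is differentiated at \<psi>. Each summand has order at least s
  - D times a product of differences lacking two nodes, whose order is at least D - \<beta>.\<close>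

lemma lead_pderiv:
  assumes G: "psupp_dvd n G" and s: "lead (int s) a (hat (poly G \<psi>))" "s < total"
  shows "\<exists>a. lead (int s - int \<beta>) a (hat (poly (pderiv G) \<psi>))"
proof -
  obtain T0 T1 where T: "G = T0 + semiroot * T1" 
    "map_poly hat T0 = (\<Sum>\<tau><d. smult (hat (poly G (node \<tau>)) / hat (node_diff \<tau>)) (\<Prod>k\<in>{..<d}-{\<tau>}. [:- hat (node k), 1:]))"
    by (rule interpolation)
  have "poly semiroot (node 0) = 0" unfolding semiroot_def using d_pos by (auto simp: poly_prod)
  then have f0: "poly semiroot \<psi> = 0" by (simp only: node_0)
  have "poly (pderiv semiroot) (node 0) = node_diff 0"
    unfolding semiroot_def node_diff_def using d_pos by (subst poly_pderiv_prod_root) auto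
  then have f1: "poly (pderiv semiroot) \<psi> = node_diff 0" by (simp only: node_0)
  have factor: "\<exists>a. lead (int D - int \<beta>) a (\<Prod>k\<in>{..<d}-{\<tau>}-{m}. hat \<psi> - hat (node k))"
    if tm: "\<tau> < d" "m < d" "m \<noteq> \<tau>" for \<tau> m
  proof (cases "\<tau> = 0 \<or> m = 0")
    case False
    then have "(\<Prod>k\<in>{..<d}-{\<tau>}-{m}. hat \<psi> - hat (node k)) = 0"
      using d_pos by (intro prod_zero) (auto intro!: bexI[of _ 0] simp: node_0)
    then show ?thesis by (intro exI[of _ 0]) (simp only: lead_0)
  next
    case True
    \<comment> \<open>One of the two omitted indices is 0, so the sum is the other one; omitting it
      lowers the order D by \<open>c j\<close>, less than \<beta>.\<close>
    define j where "j = \<tau> + m"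
    have j: "0 < j" "j < d" "{..<d}-{\<tau>}-{m} = {..<d}-{0}-{j}" using tm True by (auto simp: j_def)
    have "lead (\<Sum>k\<in>{..<d}-{0}-{j}. int (c k)) (\<Prod>k\<in>{..<d}-{0}-{j}. \<gamma> k) (\<Prod>k\<in>{..<d}-{0}-{j}. hat (\<psi> - node k))"
      by (rule lead_prod) (auto intro: lead_psi_node)
    moreover have "(\<Sum>k\<in>{..<d}-{0}-{j}. int (c k)) = int D - int (c j)"
      unfolding D_def using j by (simp add: sum.remove[of "{..<d}-{0}" j])
    moreover have "int D - int \<beta> < int D - int (c j)" using c_less j by simp
    ultimately have "lead (int D - int \<beta>) 0 (\<Prod>k\<in>{..<d}-{0}-{j}. hat (\<psi> - node k))"
      by (simp only: lead_weaken)
    then show ?thesis unfolding j(3) hat_diff by blast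
  qed
  have dT0: "\<exists>a. lead (int s - int \<beta>) a (hat (poly (pderiv T0) \<psi>))"
  proof -
    have e: "hat (poly (pderiv T0) \<psi>) = (\<Sum>\<tau><d. \<Sum>m\<in>{..<d}-{\<tau>}. hat (poly G (node \<tau>)) / hat (node_diff \<tau>) * (\<Prod>k\<in>{..<d}-{\<tau>}-{m}. hat \<psi> - hat (node k)))"
    proof -
      have "hat (poly (pderiv T0) \<psi>) = poly (pderiv (map_poly hat T0)) (hat \<psi>)"
        by (simp only: pderiv_hat poly_hat)
      also have "\<dots> = (\<Sum>\<tau><d. hat (poly G (node \<tau>)) / hat (node_diff \<tau>) * (\<Sum>m\<in>{..<d}-{\<tau>}. (\<Prod>k\<in>{..<d}-{\<tau>}-{m}. hat \<psi> - hat (node k))))"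
        unfolding T(2) by (simp add: pderiv_sum pderiv_smult pderiv_prod poly_sum poly_prod pderiv_pCons)
      finally show ?thesis by (simp only: sum_distrib_left)
    qed
    have "\<exists>a. lead (int s - int \<beta>) a (hat (poly G (node \<tau>)) / hat (node_diff \<tau>) * (\<Prod>k\<in>{..<d}-{\<tau>}-{m}. hat \<psi> - hat (node k)))"
      if tm: "\<tau> < d" "m < d" "m \<noteq> \<tau>" for \<tau> m
    proof -
      obtain a' where a': "lead (int D - int \<beta>) a' (\<Prod>k\<in>{..<d}-{\<tau>}-{m}. hat \<psi> - hat (node k))"
        using factor[OF tm] by blast
      from lead_mult[OF lead_divide[OF lead_rot[OF s(1), of "\<zeta> ^ \<tau>"] lead_node_diff[OF tm(1)] node_diff_coeff_nz] this]
      show ?thesis unfolding poly_node[OF G] by (auto simp: algebra_simps)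
    qed
    then obtain a where "\<And>\<tau> m. \<tau> < d \<Longrightarrow> m < d \<Longrightarrow> m \<noteq> \<tau> \<Longrightarrow> lead (int s - int \<beta>) (a \<tau> m) (hat (poly G (node \<tau>)) / hat (node_diff \<tau>) * (\<Prod>k\<in>{..<d}-{\<tau>}-{m}. hat \<psi> - hat (node k)))"
      by metis
    then have "lead (int s - int \<beta>) (\<Sum>\<tau><d. \<Sum>m\<in>{..<d}-{\<tau>}. a \<tau> m) (hat (poly (pderiv T0) \<psi>))"
      unfolding e by (intro lead_sum) auto
    then show ?thesis by blast
  qed
  have "hat (poly (pderiv G) \<psi>) = hat (poly (pderiv T0) \<psi>) + hat (node_diff 0) * hat (poly T1 \<psi>)"
    by (subst T(1)) (simp add: pderiv_add pderiv_mult f0 f1 hat_add hat_mult)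
  \<comment> \<open>\<open>s < total = \<beta> + D\<close> places this term beyond order
    \<open>s - \<beta>\<close>.\<close>
  moreover have "lead (int s - int \<beta>) (if int s - int \<beta> = int D + 0 then \<Gamma> * fps_nth (poly T1 \<psi>) 0 else 0) (hat (node_diff 0) * hat (poly T1 \<psi>))"
    using lead_mult[OF lead_node_diff_0 lead_fps_0[of "poly T1 \<psi>"]] s(2) total_eq
    by (auto intro: lead_weaken)
  ultimately show ?thesis using dT0 lead_add by metis
qed

text \<open>Every Lagrange numerator is monic of degree d - 1, so the sum is the coefficient of
  y^(d-1) in the remainder of K, a power series.\<close>

lemma trace_integral: "\<exists>a. lead 0 a (\<Sum>\<tau><d. hat (poly K (node \<tau>)) / hat (node_diff \<tau>))"
proof -
  obtain T0 T1 where T: "K = T0 + semiroot * T1" 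
    "map_poly hat T0 = (\<Sum>\<tau><d. smult (hat (poly K (node \<tau>)) / hat (node_diff \<tau>)) (\<Prod>k\<in>{..<d}-{\<tau>}. [:- hat (node k), 1:]))"
    by (rule interpolation)
  have one: "coeff (\<Prod>k\<in>{..<d}-{\<tau>}. [:- hat (node k), 1:]) (d - 1) = 1" if "\<tau> < d" for \<tau>
    using coeff_prod_linear[of "{..<d}-{\<tau>}" "\<lambda>k. hat (node k)"] that by simp
  have "hat (coeff T0 (d - 1)) = coeff (map_poly hat T0) (d - 1)"
    by (simp add: coeff_map_poly)
  also have "\<dots> = (\<Sum>\<tau><d. hat (poly K (node \<tau>)) / hat (node_diff \<tau>))"
    unfolding T(2) coeff_sum by (intro sum.cong) (simp_all only: coeff_smult one lessThan_iff mult_1_right)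
  finally show ?thesis using lead_fps_0 by metis
qed

lemma betabar_irreducible:
  assumes A: "psupp_dvd n A" and B: "psupp_dvd n B" and G: "psupp_dvd n G"
    and x: "x = theta_xn * poly A \<phi> + poly B \<phi> * theta \<phi>" "x \<noteq> 0"
    and g: "poly G \<phi> \<noteq> 0" "subdegree (poly G \<phi>) > 0"
  shows "subdegree x + subdegree (poly G \<phi>) \<noteq> total"
proof
  assume sum: "subdegree x + subdegree (poly G \<phi>) = total"
  let ?s = "subdegree (poly G \<phi>)" and ?l = "subdegree x" and ?b = "poly B \<psi>" and ?w = "trunc_form A B"
  let ?gy = "poly (pderiv G) \<psi>"
  \<comment> \<open>\<open>theta\<close> leaves no constant term, so forms have positive order.
    Hence the order of G is below \<open>total\<close> and transfers to \<psi>.\<close>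
  have x0: "fps_nth x 0 = 0" unfolding x(1) theta_xn_def by (simp add: theta_nth)
  then have l: "?l > 0" using x(2) by (metis neq0_conv nth_subdegree_nonzero)
  have s: "poly G \<psi> \<noteq> 0" "subdegree (poly G \<psi>) = ?s"
    using subdegree_transfer[OF G g(1)] sum l by auto
  then have "e dvd ?s"
    using e_dvd_subdegree supp_dvd_poly[OF G e_dvd_n psi] by metis
  then have "\<not> e dvd ?l" using not_e_dvd_total sum by (metis dvd_add)
  from form_value[OF A B x _ this] sum g(2)
  have b: "?b \<noteq> 0" "subdegree ?b + \<beta> = ?l" "lead (int ?l) 0 (hat ?w)" by auto
  \<comment> \<open>This is \<open>theta_xn\<close> times B G_x - A G_y at \<psi>, the coefficient
    of the wedge of the form with dG up to sign, written with quantities whose orders are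
    known.\<close>
  define kap where "kap = ?b * theta (poly G \<psi>) - ?gy * ?w"
  have qs: "subdegree ?b + ?s = D" using b(2) sum total_eq by simp
  \<comment> \<open>The first product has order exactly D, with the nonzero factor \<open>?s\<close>
    from \<open>theta\<close>. The second has order above (s - \<beta>) + l = D, by
    \<open>lead_pderiv\<close> and the vanishing of the form along \<psi> beyond l.\<close>
  obtain k0 where k0: "k0 \<noteq> 0" "lead (int D) k0 (hat kap)"
  proof -
    have ls: "lead (int ?s) (fps_nth (poly G \<psi>) ?s) (hat (poly G \<psi>))"
      using lead_subdegree[OF s(1)] s(2) by simp
    from lead_mult[OF lead_subdegree[OF b(1)] lead_theta[OF this]]
    have 1: "lead (int D) (fps_nth ?b (subdegree ?b) * (of_nat ?s * fps_nth (poly G \<psi>) ?s)) (hat (?b * theta (poly G \<psi>)))"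
      unfolding hat_mult by (simp flip: qs)
    obtain a where "lead (int ?s - int \<beta>) a (hat ?gy)" using lead_pderiv[OF G ls] sum l by auto
    from lead_mult[OF this b(3)] have 2: "lead (int D) 0 (hat (?gy * ?w))"
      using sum total_eq by (simp add: hat_mult algebra_simps) (metis add.commute add_diff_cancel_left' of_nat_add)
    from lead_diff[OF 1 2] have "lead (int D) (fps_nth ?b (subdegree ?b) * (of_nat ?s * fps_nth (poly G \<psi>) ?s)) (hat kap)"
      by (simp add: kap_def hat_diff)
    then show ?thesis using that b(1) s g(2) by (metis mult_eq_0_iff nth_subdegree_nonzero of_nat_eq_0_iff neq0_conv)
  qed
  obtain Gx where Gx: "smult theta_xn Gx = map_poly theta G"
    using theta_div_X_power[OF G n(2)] unfolding theta_xn_def by blast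
  define K where "K = B * Gx - A * pderiv G"
  have K: "theta_xn * poly K (node \<tau>) = rot (\<zeta> ^ \<tau>) kap" for \<tau>
  proof -
    let ?r = "rot (\<zeta> ^ \<tau>)"
    have 1: "theta_xn * poly Gx y = theta (poly G y) - poly (pderiv G) y * theta y" for y
      using theta_poly[of G y] by (simp flip: Gx)
    have rx: "rot (\<zeta> ^ \<tau>) theta_xn = theta_xn" by (rule rot_supp_dvd[OF supp_theta_xn zeta_root])
    have rt: "theta (node \<tau>) = ?r (theta \<psi>)" by (simp add: theta_rot node_def)
    have "theta_xn * poly K (node \<tau>) = poly B (node \<tau>) * (theta_xn * poly Gx (node \<tau>)) - theta_xn * poly A (node \<tau>) * poly (pderiv G) (node \<tau>)"
      by (simp add: K_def algebra_simps)
    also have "\<dots> = ?r kap"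
      unfolding 1 poly_node[OF G] poly_node[OF A] poly_node[OF B] poly_node[OF psupp_dvd_pderiv[OF G]] theta_rot rt
      unfolding kap_def trunc_form_def rot_hom rx by (simp add: algebra_simps)
    finally show ?thesis .
  qed
  \<comment> \<open>The powers of \<zeta> in numerator and denominator cancel, so all d summands
    have the same leading coefficient and their poles of order n add up.\<close>
  have summand: "lead (- int n) (k0 / of_nat n / \<Gamma>) (hat (poly K (node \<tau>)) / hat (node_diff \<tau>))" if t: "\<tau> < d" for \<tau>
  proof -
    have nz: "hat theta_xn \<noteq> 0" using lead_nonzero[OF lead_theta_xn] n(2) by auto
    have e: "hat (poly K (node \<tau>)) = hat (rot (\<zeta> ^ \<tau>) kap) / hat theta_xn"
      using nz by (simp add: K[symmetric] hat_mult)
    from lead_divide[OF lead_divide[OF lead_rot[OF k0(2), of "\<zeta> ^ \<tau>"] lead_theta_xn] lead_node_diff[OF t] node_diff_coeff_nz]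
    show ?thesis unfolding e using n(2) zeta_nz by (simp add: field_simps)
  qed
  have "lead (- int n) (\<Sum>\<tau><d. k0 / of_nat n / \<Gamma>) (\<Sum>\<tau><d. hat (poly K (node \<tau>)) / hat (node_diff \<tau>))"
    by (rule lead_sum) (use summand in auto)
  moreover obtain a where "lead 0 a (\<Sum>\<tau><d. hat (poly K (node \<tau>)) / hat (node_diff \<tau>))"
    using trace_integral by blast
  then have "lead (- int n) 0 (\<Sum>\<tau><d. hat (poly K (node \<tau>)) / hat (node_diff \<tau>))"
    by (rule lead_weaken) (use n(2) in simp)
  ultimately have "(\<Sum>\<tau><d. k0 / of_nat n / \<Gamma>) = 0" by (simp add: lead_nth)
  then show False using k0(1) n(2) \<Gamma>_nz d_pos by simp
qed

end

section \<open>Puiseux characteristic exponents\<close>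

lemma exp_root_unity_power:
  assumes "n > 0"
  shows "exp (2 * of_real pi * \<i> / of_nat n) ^ k = (1::complex) \<longleftrightarrow> n dvd k"
proof -
  have "exp (2 * of_real pi * \<i> / of_nat n) ^ k = exp (2 * of_real pi * \<i> * of_nat k / of_nat n)"
    by (simp add: exp_of_nat_mult[symmetric] mult_ac)
  then show ?thesis using complex_root_unity_eq_1[of n k] assms by simp
qed

text \<open>Over the multiples of m this is a geometric sum in \<open>\<omega> ^ m\<close>, an N-th
  root of unity.\<close>

lemma sum_roots_unity:
  fixes \<omega> :: complex
  assumes "\<omega> ^ (N * m) = 1" "m > 0"
  shows "(\<Sum>\<tau><N * m. if m dvd \<tau> then \<omega> ^ \<tau> else 0) = of_nat (if \<omega> ^ m = 1 then N else 0)"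
proof -
  have "(\<Sum>\<tau><N * m. if m dvd \<tau> then \<omega> ^ \<tau> else 0) = (\<Sum>\<tau>\<in>{\<tau>\<in>{..<N * m}. m dvd \<tau>}. \<omega> ^ \<tau>)"
    by (rule sum.inter_filter[symmetric]) simp
  also have "\<dots> = (\<Sum>i<N. \<omega> ^ (m * i))"
    using assms(2)
    by (intro sum.reindex_bij_witness[of _ "\<lambda>i. m * i" "\<lambda>\<tau>. \<tau> div m"])
       (auto simp: less_mult_imp_div_less mult.commute)
  also have "\<dots> = (\<Sum>i<N. (\<omega> ^ m) ^ i)" by (simp add: power_mult)
  also have "\<dots> = of_nat (if \<omega> ^ m = 1 then N else 0)"
  proof (cases "\<omega> ^ m = 1")
    case False
    have "(\<omega> ^ m) ^ N = 1" using assms by (simp flip: power_mult add: mult.commute)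
    with False show ?thesis by (simp add: geometric_sum)
  qed simp
  finally show ?thesis .
qed

text \<open>Indices are shifted: \<open>E k\<close> is e_k but \<open>b k\<close> is the
  characteristic exponent of index k + 1. The level treated is \<open>Suc J\<close>, with \<psi> a
  series in powers of t^(e_J).\<close>

locale puiseux_level =
  fixes n :: nat and \<phi> :: "complex fps" and J :: nat
  assumes singular: "n \<ge> 2"
    and primitive: "\<And>d. d > 1 \<Longrightarrow> d dvd n \<Longrightarrow> \<exists>b. fps_nth \<phi> b \<noteq> 0 \<and> \<not> d dvd b"
    and J: "Suc J \<le> puiseux_genus n \<phi>"
begin

abbreviation E :: "nat \<Rightarrow> nat" where "E \<equiv> puiseux_e n \<phi>"
definition b :: "nat \<Rightarrow> nat" where "b k = puiseux_beta n \<phi> (Suc k)"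
definition \<delta> :: "nat \<Rightarrow> nat" where "\<delta> k = (if k = 0 then b 0 else b k - b (k - 1))"
text \<open>A telescoping sum whose value is \<open>b k\<close> for the last k up to J with n
  dividing \<open>\<tau> * E k\<close>. The form as a sum of conditions lets sums over \<tau> be
  computed by \<open>sum_roots_unity\<close>.\<close>

definition contact :: "nat \<Rightarrow> nat" where
  "contact \<tau> = (\<Sum>k\<le>J. if n dvd \<tau> * E k then \<delta> k else 0)"
definition \<psi> :: "complex fps" where "\<psi> = Abs_fps (\<lambda>k. if k < b J then fps_nth \<phi> k else 0)"
definition \<zeta> :: complex where "\<zeta> = exp (2 * of_real pi * \<i> / of_nat n)"

lemma E_Suc: "E (Suc k) = gcd (E k) (b k)"
  by (simp add: b_def puiseux_beta_def)

lemma E_dvd: "i \<le> k \<Longrightarrow> E k dvd E i"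
  by (induction k rule: dec_induct) (auto simp: E_Suc simp del: puiseux_e.simps intro: dvd_trans[rotated])

lemma E_dvd_n: "E k dvd n"
  using E_dvd[of 0 k] by simp

lemma E_pos: "E k > 0"
  using E_dvd_n[of k] singular by (auto intro!: Nat.gr0I)

lemma E_gt_1: "k \<le> J \<Longrightarrow> E k > 1"
proof -
  assume "k \<le> J"
  then have "k < puiseux_genus n \<phi>" using J by simp
  then have "E k \<noteq> 1" unfolding puiseux_genus_def by (rule not_less_Least)
  then show ?thesis using E_pos[of k] by simp
qed

lemma b_spec:
  assumes "k \<le> J"
  shows "fps_nth \<phi> (b k) \<noteq> 0" "\<not> E k dvd b k"
    and "\<And>i. i < b k \<Longrightarrow> fps_nth \<phi> i \<noteq> 0 \<Longrightarrow> E k dvd i"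
proof -
  \<comment> \<open>Below the genus \<open>E k\<close> exceeds 1, so \<open>primitive\<close>
    ensures that the \<open>LEAST\<close> defining \<open>b k\<close> is attained.\<close>
  have ex: "\<exists>i. fps_nth \<phi> i \<noteq> 0 \<and> \<not> E k dvd i"
    using primitive[OF E_gt_1[OF assms] E_dvd_n] .
  have b: "b k = (LEAST i. fps_nth \<phi> i \<noteq> 0 \<and> \<not> E k dvd i)" by (simp add: b_def puiseux_beta_def)
  show "fps_nth \<phi> (b k) \<noteq> 0" "\<not> E k dvd b k" unfolding b using LeastI_ex[OF ex] by auto
  show "i < b k \<Longrightarrow> fps_nth \<phi> i \<noteq> 0 \<Longrightarrow> E k dvd i" for i unfolding b using not_less_Least by blast
qed

lemma b_less: 
  assumes "k < l" "l \<le> J" shows "b k < b l"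
proof (rule ccontr)
  assume "\<not> b k < b l"
  then have "b l < b k \<or> b l = b k" by auto
  moreover have "E (Suc k) dvd b k" by (simp add: E_Suc del: puiseux_e.simps)
  moreover have "E (Suc k) dvd b l" if "b l < b k"
    using b_spec(3)[of k "b l"] b_spec(1)[of l] assms that by (auto simp: E_Suc simp del: puiseux_e.simps)
  ultimately have "E (Suc k) dvd b l" by auto
  moreover have "E l dvd E (Suc k)" using assms by (intro E_dvd) auto
  ultimately show False using b_spec(2)[OF assms(2)] dvd_trans by blast
qed

lemma delta_sum: "k \<le> J \<Longrightarrow> (\<Sum>i\<le>k. \<delta> i) = b k"
proof (induction k)
  case (Suc k)
  then show ?case using b_less[of k "Suc k"] by (simp add: \<delta>_def)
qed (simp add: \<delta>_def)

lemma delta_pos: "\<delta> J > 0"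
  using b_less[of "J - 1" J] b_spec(2)[of 0] by (cases J) (auto simp: \<delta>_def intro!: Nat.gr0I)

lemma contact_0: "contact 0 = b J"
  unfolding contact_def using delta_sum[of J] by simp

lemma n_factor: "n = (n div E k) * E k"
  using E_dvd_n by simp

text \<open>Since each \<open>E (Suc k)\<close> divides \<open>E k\<close>, the condition holds on
  an initial segment of indices. The bound on \<tau> excludes J, so the segment ends at some smaller
  k.\<close>

lemma contact_eq:
  assumes "0 < \<tau>" "\<tau> < n div E J"
  obtains k where "k < J" "contact \<tau> = b k" "n dvd \<tau> * E k" "\<not> n dvd \<tau> * E (Suc k)"
proof -
  define P where "P k \<longleftrightarrow> k \<le> J \<and> n dvd \<tau> * E k" for k
  have "P 0" by (simp add: P_def)
  have "\<not> n dvd \<tau> * E J"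
  proof
    assume "n dvd \<tau> * E J"
    then have "(n div E J) * E J dvd \<tau> * E J" by (simp flip: n_factor)
    then have "n div E J dvd \<tau>" using E_pos[of J] by simp
    with assms show False by (auto dest: dvd_imp_le)
  qed
  define k where "k = (GREATEST k. P k)"
  have bound: "\<And>y. P y \<Longrightarrow> y \<le> J" by (simp add: P_def)
  have k: "P k" unfolding k_def by (rule GreatestI_nat[of P 0 J]) (use \<open>P 0\<close> bound in auto)
  have max: "y \<le> k" if "P y" for y unfolding k_def by (rule Greatest_le_nat[of P y J]) (use that bound in auto)
  have "k \<noteq> J" using k \<open>\<not> n dvd \<tau> * E J\<close> by (auto simp: P_def)
  then have kJ: "k < J" using k by (simp add: P_def)
  have iff: "n dvd \<tau> * E i \<longleftrightarrow> i \<le> k" if "i \<le> J" for i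
  proof
    assume "n dvd \<tau> * E i" then show "i \<le> k" using max that by (simp add: P_def)
  next
    assume "i \<le> k"
    then have "\<tau> * E k dvd \<tau> * E i" using E_dvd by (intro mult_dvd_mono) auto
    moreover have "n dvd \<tau> * E k" using k by (simp add: P_def)
    ultimately show "n dvd \<tau> * E i" by (rule dvd_trans[rotated])
  qed
  have "contact \<tau> = (\<Sum>i\<le>J. if i \<le> k then \<delta> i else 0)"
    unfolding contact_def by (intro sum.cong) (auto simp: iff)
  also have "\<dots> = (\<Sum>i\<in>{i\<in>{..J}. i \<le> k}. \<delta> i)" by (rule sum.inter_filter[symmetric]) simp
  also have "{i\<in>{..J}. i \<le> k} = {..k}" using kJ by auto
  also have "(\<Sum>i\<in>{..k}. \<delta> i) = b k" using kJ by (intro delta_sum) simp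
  finally have "contact \<tau> = b k" .
  with that[of k] kJ k iff[of "Suc k"] show ?thesis by (simp add: P_def del: puiseux_e.simps)
qed

text \<open>After exchanging the sums, each condition becomes divisibility of \<tau> by
  \<open>n div E k\<close>. The result is a natural number, which makes positivity visible.\<close>

lemma contact_sum:
  assumes "\<omega> ^ (n div E J) = (1::complex)"
  shows "(\<Sum>\<tau><n div E J. of_nat (contact \<tau>) * \<omega> ^ \<tau>) =
    of_nat (\<Sum>k\<le>J. \<delta> k * (if \<omega> ^ (n div E k) = 1 then E k div E J else 0))"
proof -
  have "(\<Sum>\<tau><n div E J. of_nat (contact \<tau>) * \<omega> ^ \<tau>) =
     (\<Sum>\<tau><n div E J. \<Sum>k\<le>J. of_nat (\<delta> k) * (if n div E k dvd \<tau> then \<omega> ^ \<tau> else 0))"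
  proof (intro sum.cong refl)
    fix \<tau>
    have "n dvd \<tau> * E k \<longleftrightarrow> n div E k dvd \<tau>" for k
      using n_factor[of k] E_pos[of k] by (metis dvd_times_right_cancel_iff mult.commute neq0_conv)
    then show "of_nat (contact \<tau>) * \<omega> ^ \<tau> = (\<Sum>k\<le>J. of_nat (\<delta> k) * (if n div E k dvd \<tau> then \<omega> ^ \<tau> else 0))"
      unfolding contact_def by (auto simp: sum_distrib_right intro!: sum.cong)
  qed
  also have "\<dots> = (\<Sum>k\<le>J. of_nat (\<delta> k) * (\<Sum>\<tau><n div E J. if n div E k dvd \<tau> then \<omega> ^ \<tau> else 0))"
    by (subst sum.swap) (simp add: sum_distrib_left)
  also have "\<dots> = (\<Sum>k\<le>J. of_nat (\<delta> k) * of_nat (if \<omega> ^ (n div E k) = 1 then E k div E J else 0))"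
  proof (intro sum.cong refl)
    fix k assume k: "k \<in> {..J}"
    then have "E J dvd E k" by (intro E_dvd) simp
    have "E k div E J * (n div E k) * E J = n div E k * (E k div E J * E J)" by (simp only: mult_ac)
    also have "\<dots> = n" using \<open>E J dvd E k\<close> E_dvd_n[of k] by simp
    finally have nd: "n div E J = E k div E J * (n div E k)"
      using E_pos[of J] by (metis nonzero_mult_div_cancel_right less_irrefl)
    have "n div E k > 0" using n_factor[of k] singular by (metis gr0I mult_0 not_numeral_le_zero)
    with sum_roots_unity[of \<omega> "E k div E J" "n div E k"] assms
    show "of_nat (\<delta> k) * (\<Sum>\<tau><n div E J. if n div E k dvd \<tau> then \<omega> ^ \<tau> else 0) =
       of_nat (\<delta> k) * of_nat (if \<omega> ^ (n div E k) = 1 then E k div E J else 0)"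
      by (simp flip: nd)
  qed
  finally show ?thesis by simp
qed

text \<open>The recursion multiplied by e_(k+1), using e_(k+1) n_(k+1) = e_k.\<close>

lemma betabar_sum: "k \<le> J \<Longrightarrow> E k * puiseux_betabar n \<phi> (Suc k) = (\<Sum>i\<le>k. \<delta> i * E i)"
proof (induction k)
  case 0 then show ?case by (simp add: \<delta>_def b_def)
next
  case (Suc k)
  have "E (Suc k) * puiseux_n n \<phi> (Suc k) = E k"
    using E_dvd[of k "Suc k"] by (simp add: puiseux_n_def del: puiseux_e.simps)
  moreover have "puiseux_betabar n \<phi> (Suc (Suc k)) = puiseux_n n \<phi> (Suc k) * puiseux_betabar n \<phi> (Suc k) + \<delta> (Suc k)"
    using b_less[of k "Suc k"] Suc.prems by (simp add: \<delta>_def b_def)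
  ultimately have "E (Suc k) * puiseux_betabar n \<phi> (Suc (Suc k)) = E k * puiseux_betabar n \<phi> (Suc k) + \<delta> (Suc k) * E (Suc k)"
    by (simp only: distrib_left mult.assoc[symmetric]) (simp only: mult.commute)
  then show ?case using Suc by (simp del: puiseux_e.simps puiseux_betabar.simps)
qed

lemma contact_total: "(\<Sum>\<tau><n div E J. contact \<tau>) = puiseux_betabar n \<phi> (Suc J)"
proof -
  have "of_nat (\<Sum>\<tau><n div E J. contact \<tau>) = (of_nat (\<Sum>k\<le>J. \<delta> k * (E k div E J)) :: complex)"
    using contact_sum[of 1] by simp
  then have "(\<Sum>\<tau><n div E J. contact \<tau>) = (\<Sum>k\<le>J. \<delta> k * (E k div E J))"
    unfolding of_nat_eq_iff .
  then have "E J * (\<Sum>\<tau><n div E J. contact \<tau>) = (\<Sum>k\<le>J. \<delta> k * E k)"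
    by (auto simp: sum_distrib_left E_dvd intro!: sum.cong)
  also have "\<dots> = E J * puiseux_betabar n \<phi> (Suc J)" by (rule betabar_sum[symmetric]) simp
  finally show ?thesis using E_pos[of J] by simp
qed

sublocale branch_level n "n div E J" "E J" "b J" \<zeta> contact \<phi> \<psi>
proof
  show "n = n div E J * E J" by (rule n_factor)
  show "n > 0" using singular by simp
  show "\<zeta> ^ k = 1 \<longleftrightarrow> n dvd k" for k unfolding \<zeta>_def using singular by (intro exp_root_unity_power) simp
  show "supp_dvd (E J) \<psi>" using b_spec(3)[of J] by (auto simp: supp_dvd_def \<psi>_def split: if_splits)
  show "fps_nth \<phi> i = fps_nth \<psi> i" if "i < b J" for i using that by (simp add: \<psi>_def)
  show "fps_nth \<phi> (b J) \<noteq> fps_nth \<psi> (b J)" using b_spec(1)[of J] by (simp add: \<psi>_def)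
  show "\<not> E J dvd b J" by (rule b_spec(2)) simp
  show "contact 0 = b J" by (rule contact_0)
  have root: "\<zeta> ^ k = 1 \<longleftrightarrow> n dvd k" for k unfolding \<zeta>_def using singular by (intro exp_root_unity_power) simp
  fix \<tau> assume t: "0 < \<tau>" "\<tau> < n div E J"
  then obtain k where k: "k < J" "contact \<tau> = b k" "n dvd \<tau> * E k" "\<not> n dvd \<tau> * E (Suc k)"
    by (rule contact_eq)
  show "contact \<tau> < b J" using k b_less by simp
  show "\<zeta> ^ (\<tau> * i) = 1" if "i < contact \<tau>" "fps_nth \<psi> i \<noteq> 0" for i
  proof -
    \<comment> \<open>Before \<open>b k\<close> only multiples of \<open>E k\<close> occur as
      exponents.\<close>
    have "E k dvd i" using that k b_spec(3)[of k i] by (auto simp: \<psi>_def split: if_splits)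
    then have "n dvd \<tau> * i" using k(3) by (meson dvd_trans dvd_refl mult_dvd_mono)
    then show ?thesis by (simp add: root)
  qed
  show "fps_nth \<psi> (contact \<tau>) \<noteq> 0 \<and> \<zeta> ^ (\<tau> * contact \<tau>) \<noteq> 1"
  proof
    show "fps_nth \<psi> (contact \<tau>) \<noteq> 0" using k b_less[of k J] b_spec(1)[of k] by (simp add: \<psi>_def)
    have "\<not> n dvd \<tau> * b k"
    proof
      assume "n dvd \<tau> * b k"
      \<comment> \<open>Otherwise n would divide \<tau> times gcd of \<open>E k\<close> and
        \<open>b k\<close>, contradicting the choice of k.\<close>
      then have "n dvd gcd (\<tau> * E k) (\<tau> * b k)" using k(3) by simp
      also have "\<dots> = \<tau> * E (Suc k)" by (simp add: gcd_mult_distrib_nat E_Suc del: puiseux_e.simps)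
      finally show False using k(4) by blast
    qed
    then show "\<zeta> ^ (\<tau> * contact \<tau>) \<noteq> 1" by (simp add: root k(2))
  qed
next
  fix \<omega> :: complex assume w: "\<omega> ^ (n div E J) = 1"
  \<comment> \<open>The summand k = J is always present and positive.\<close>
  have "\<delta> J * (if \<omega> ^ (n div E J) = 1 then E J div E J else 0) > 0"
    using delta_pos E_pos[of J] w by simp
  then have "(\<Sum>k\<le>J. \<delta> k * (if \<omega> ^ (n div E k) = 1 then E k div E J else 0)) > 0"
    by (intro sum_pos2[of _ J]) auto
  then show "(\<Sum>\<tau><n div E J. of_nat (contact \<tau>) * \<omega> ^ \<tau>) \<noteq> 0"
    unfolding contact_sum[OF w] of_nat_eq_0_iff by (rule less_imp_neq[symmetric])
qed

lemma total_eq_betabar: "total = puiseux_betabar n \<phi> (Suc J)"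
  by (simp only: total_def contact_total)

end

section \<open>Values of functions and of differential forms\<close>

lemma psupp_dvd_0: "psupp_dvd n 0" and psupp_dvd_1: "psupp_dvd n 1"
  by (auto simp: psupp_dvd_def supp_dvd_def one_pCons coeff_pCons split: nat.splits)

lemma psupp_dvd_add: "psupp_dvd n P \<Longrightarrow> psupp_dvd n Q \<Longrightarrow> psupp_dvd n (P + Q)"
  by (auto simp: psupp_dvd_def intro: supp_dvd_add)

lemma psupp_dvd_mult: "psupp_dvd n P \<Longrightarrow> psupp_dvd n Q \<Longrightarrow> psupp_dvd n (P * Q)"
proof (induction P)
  case (pCons a P)
  have "supp_dvd n a" using pCons.prems by (simp add: psupp_dvd_pCons)
  then have "psupp_dvd n (smult a Q)" using pCons.prems by (auto simp: psupp_dvd_def intro: supp_dvd_mult)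
  moreover have "psupp_dvd n (pCons 0 (P * Q))" using pCons by (auto simp: psupp_dvd_pCons supp_dvd_def)
  ultimately show ?case by (auto simp: intro: psupp_dvd_add)
qed (simp add: psupp_dvd_0)

section \<open>Replacing convergent double series by polynomials in y, and back\<close>

lemma subdegree_agree:
  assumes "x \<noteq> 0" "\<And>k. k \<le> subdegree x \<Longrightarrow> fps_nth y k = fps_nth x k"
  shows "y \<noteq> 0 \<and> subdegree y = subdegree x"
proof -
  have "fps_nth y (subdegree x) \<noteq> 0" using assms by simp
  moreover have "fps_nth y i = 0" if "i < subdegree x" for i
    using assms(2)[of i] that by (simp add: nth_less_subdegree_zero)
  ultimately show ?thesis by (auto intro: subdegreeI)
qed

lemma mult_nth_cong:
  assumes "\<And>k. k \<le> N \<Longrightarrow> fps_nth x k = fps_nth y k" "k \<le> N"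
  shows "fps_nth (x * z) k = fps_nth (y * z) k"
  using assms by (auto simp: fps_mult_nth intro!: sum.cong)

lemma power_nth_0: "fps_nth \<phi> 0 = 0 \<Longrightarrow> k < j \<Longrightarrow> fps_nth (\<phi> ^ j) k = (0::complex)"
  by (simp add: startsby_zero_power_prefix)

text \<open>Powers of \<phi> beyond k contribute nothing to t^k, as \<phi> has no constant term, and
  the coefficients of P only involve exponents n i.\<close>

lemma comp_branch_poly:
  assumes n: "n > 0" and \<phi>: "fps_nth \<phi> 0 = 0" and P: "psupp_dvd n P"
  shows "comp_branch (\<lambda>i j. fps_nth (coeff P j) (n * i)) n \<phi> = poly P \<phi>"
proof (rule fps_ext)
  fix k
  have term_eq: "(\<Sum>i\<le>k. fps_nth (coeff P j) (n * i) * fps_nth (fps_X ^ (n * i) * \<phi> ^ j) k)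
      = fps_nth (coeff P j * \<phi> ^ j) k" for j
  proof -
    let ?g = "\<lambda>m. fps_nth (coeff P j) m * fps_nth (\<phi> ^ j) (k - m)"
    have "fps_nth (coeff P j * \<phi> ^ j) k = (\<Sum>m\<in>{0..k}. ?g m)" by (simp add: fps_mult_nth)
    also have "\<dots> = (\<Sum>m\<in>(\<lambda>i. n * i) ` {i. n * i \<le> k}. ?g m)"
    proof (rule sum.mono_neutral_right)
      show "\<forall>m\<in>{0..k} - (\<lambda>i. n * i) ` {i. n * i \<le> k}. ?g m = 0"
        using P by (fastforce simp: psupp_dvd_def supp_dvd_def elim!: dvdE)
    qed auto
    also have "\<dots> = (\<Sum>i\<in>{i. n * i \<le> k}. ?g (n * i))"
      using n by (subst sum.reindex) (auto simp: inj_on_def)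
    also have "\<dots> = (\<Sum>i\<in>{i\<in>{..k}. n * i \<le> k}. ?g (n * i))"
    proof (rule sum.cong)
      have "i \<le> n * i" for i using n by simp
      then show "{i. n * i \<le> k} = {i\<in>{..k}. n * i \<le> k}" using le_trans by blast
    qed simp
    also have "\<dots> = (\<Sum>i\<le>k. if n * i \<le> k then ?g (n * i) else 0)" by (rule sum.inter_filter) simp
    also have "\<dots> = (\<Sum>i\<le>k. fps_nth (coeff P j) (n * i) * fps_nth (fps_X ^ (n * i) * \<phi> ^ j) k)"
      by (intro sum.cong) (auto simp: fps_X_power_mult_nth)
    finally show ?thesis by simp
  qed
  have "fps_nth (comp_branch (\<lambda>i j. fps_nth (coeff P j) (n * i)) n \<phi>) k = (\<Sum>j\<le>k. fps_nth (coeff P j * \<phi> ^ j) k)"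
    unfolding comp_branch_def fps_nth_Abs_fps by (subst sum.swap) (simp add: term_eq)
  also have "\<dots> = (\<Sum>j\<le>max k (degree P). fps_nth (coeff P j * \<phi> ^ j) k)"
  proof (rule sum.mono_neutral_left)
    show "\<forall>j\<in>{..max k (degree P)} - {..k}. fps_nth (coeff P j * \<phi> ^ j) k = 0"
      by (auto simp: fps_mult_nth power_nth_0[OF \<phi>] intro!: sum.neutral)
  qed auto
  also have "\<dots> = fps_nth (poly P \<phi>) k"
  proof -
    have "(\<Sum>j\<le>max k (degree P). fps_nth (coeff P j * \<phi> ^ j) k) = (\<Sum>j\<le>degree P. fps_nth (coeff P j * \<phi> ^ j) k)"
      by (rule sum.mono_neutral_right) (auto simp: coeff_eq_0)
    then show ?thesis by (simp add: poly_altdef fps_sum_nth)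
  qed
  finally show "fps_nth (comp_branch (\<lambda>i j. fps_nth (coeff P j) (n * i)) n \<phi>) k = fps_nth (poly P \<phi>) k" .
qed

lemma comp_branch_cong:
  assumes "\<And>i j. i \<le> k \<Longrightarrow> j \<le> k \<Longrightarrow> c i j = c' i j"
  shows "fps_nth (comp_branch c n \<phi>) k = fps_nth (comp_branch c' n \<phi>) k"
  using assms by (simp add: comp_branch_def)

text \<open>The coefficient of t^k only sees \<open>c i j\<close> with i and j at most k, so cutting
  off at y^N changes nothing up to order N.\<close>

lemma comp_branch_approx:
  assumes n: "n > 0" and \<phi>: "fps_nth \<phi> 0 = 0"
  obtains P where "psupp_dvd n P" "fps_nth (coeff P 0) 0 = c 0 0"
    "\<And>k. k \<le> N \<Longrightarrow> fps_nth (poly P \<phi>) k = fps_nth (comp_branch c n \<phi>) k"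
proof -
  define a where "a j = Abs_fps (\<lambda>m. if n dvd m then c (m div n) j else 0)" for j
  define P where "P = (\<Sum>j\<le>N. monom (a j) j)"
  have co: "coeff P j = (if j \<le> N then a j else 0)" for j
    by (auto simp: P_def coeff_sum)
  have P: "psupp_dvd n P" by (auto simp: psupp_dvd_def supp_dvd_def co a_def)
  have "fps_nth (poly P \<phi>) k = fps_nth (comp_branch c n \<phi>) k" if "k \<le> N" for k
    unfolding comp_branch_poly[OF n \<phi> P, symmetric]
    using that n by (intro comp_branch_cong) (auto simp: co a_def)
  with P show ?thesis using that by (auto simp: co a_def)
qed

lemma conv2_finite:
  assumes "\<And>i j. c i j \<noteq> 0 \<Longrightarrow> i \<le> N \<and> j \<le> N"
  shows "conv2 c"
proof -
  have "(\<lambda>(i,j). norm (c i j) * 1 ^ (i + j)) summable_on (UNIV :: (nat \<times> nat) set)"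
  proof (rule summable_on_cong_neutral[THEN iffD1])
    show "(\<lambda>(i,j). norm (c i j) * 1 ^ (i + j)) summable_on ({..N} \<times> {..N})" by simp
  qed (use assms in auto)
  then show ?thesis unfolding conv2_def by (intro exI[of _ 1]) simp
qed

text \<open>Cutting off in both variables leaves finitely many coefficients, hence a convergent
  germ.\<close>

lemma poly_approx_conv:
  assumes n: "n > 0" and \<phi>: "fps_nth \<phi> 0 = 0" and P: "psupp_dvd n P"
  obtains c where "conv2 c" "c 0 0 = fps_nth (coeff P 0) 0"
    "\<And>k. k \<le> N \<Longrightarrow> fps_nth (comp_branch c n \<phi>) k = fps_nth (poly P \<phi>) k"
proof
  define c where "c i j = (if i \<le> N \<and> j \<le> N then fps_nth (coeff P j) (n * i) else 0)" for i j
  show "conv2 c" by (rule conv2_finite[of _ N]) (auto simp: c_def split: if_splits)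
  show "c 0 0 = fps_nth (coeff P 0) 0" by (simp add: c_def)
  show "fps_nth (comp_branch c n \<phi>) k = fps_nth (poly P \<phi>) k" if "k \<le> N" for k
    unfolding comp_branch_poly[OF n \<phi> P, symmetric]
    using that by (intro comp_branch_cong) (auto simp: c_def)
qed

text \<open>t times the pull-back coefficient: the factor t absorbs the \<open>+ 1\<close> in
  \<open>differential_values\<close>.\<close>

definition form :: "nat \<Rightarrow> complex fps \<Rightarrow> complex fps poly \<Rightarrow> complex fps poly \<Rightarrow> complex fps" where
  "form n \<phi> A B = theta (fps_X ^ n) * poly A \<phi> + poly B \<phi> * theta \<phi>"

lemma value_semigroup_eq:
  assumes n: "n > 0" and \<phi>: "fps_nth \<phi> 0 = 0"
  shows "value_semigroup n \<phi> =
    {subdegree (poly P \<phi>) | P. psupp_dvd n P \<and> fps_nth (coeff P 0) 0 = 0 \<and> poly P \<phi> \<noteq> 0}" (is "_ = ?R")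
proof (intro equalityI subsetI)
  fix s assume "s \<in> value_semigroup n \<phi>"
  then obtain c where c: "s = subdegree (comp_branch c n \<phi>)" "c 0 0 = 0" "comp_branch c n \<phi> \<noteq> 0"
    by (auto simp: value_semigroup_def)
  obtain P where P: "psupp_dvd n P" "fps_nth (coeff P 0) 0 = c 0 0"
    "\<And>k. k \<le> s \<Longrightarrow> fps_nth (poly P \<phi>) k = fps_nth (comp_branch c n \<phi>) k"
    using comp_branch_approx[OF n \<phi>, of c s] by blast
  from subdegree_agree[OF c(3) P(3)] c(1,2) P(1,2) show "s \<in> ?R" by force
next
  fix s assume "s \<in> ?R"
  then obtain P where P: "s = subdegree (poly P \<phi>)" "psupp_dvd n P" "fps_nth (coeff P 0) 0 = 0" "poly P \<phi> \<noteq> 0"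
    by auto
  obtain c where c: "conv2 c" "c 0 0 = fps_nth (coeff P 0) 0"
    "\<And>k. k \<le> s \<Longrightarrow> fps_nth (comp_branch c n \<phi>) k = fps_nth (poly P \<phi>) k"
    using poly_approx_conv[OF n \<phi> P(2), of s] by blast
  have "comp_branch c n \<phi> \<noteq> 0 \<and> s = subdegree (comp_branch c n \<phi>)"
    using subdegree_agree[OF P(4), of "comp_branch c n \<phi>"] c(3) P(1) by simp
  then show "s \<in> value_semigroup n \<phi>"
    unfolding value_semigroup_def using c(1,2) P(3) by force
qed

lemma X_pullback_form:
  "fps_X * pullback_form a b n \<phi> = comp_branch a n \<phi> * theta (fps_X ^ n) + comp_branch b n \<phi> * theta \<phi>"
  by (simp only: pullback_form_def theta_def algebra_simps)

lemma differential_values_eq: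
  assumes n: "n > 0" and \<phi>: "fps_nth \<phi> 0 = 0"
  shows "differential_values n \<phi> =
    {subdegree (form n \<phi> A B) | A B. psupp_dvd n A \<and> psupp_dvd n B \<and> form n \<phi> A B \<noteq> 0}" (is "_ = ?R")
proof -
  have agree: "fps_nth (form n \<phi> A B) k = fps_nth (fps_X * pullback_form a b n \<phi>) k"
    if "\<And>k. k \<le> N \<Longrightarrow> fps_nth (poly A \<phi>) k = fps_nth (comp_branch a n \<phi>) k"
       "\<And>k. k \<le> N \<Longrightarrow> fps_nth (poly B \<phi>) k = fps_nth (comp_branch b n \<phi>) k" "k \<le> N" for A B a b N k
    using mult_nth_cong[OF that(1,3), of "theta (fps_X ^ n)"] mult_nth_cong[OF that(2,3), of "theta \<phi>"]
    by (simp add: form_def X_pullback_form mult.commute)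
  show ?thesis
  proof (intro equalityI subsetI)
    fix l assume "l \<in> differential_values n \<phi>"
    then obtain a b where l: "l = subdegree (pullback_form a b n \<phi>) + 1" "pullback_form a b n \<phi> \<noteq> 0"
      by (auto simp: differential_values_def)
    define y where "y = fps_X * pullback_form a b n \<phi>"
    have y: "y \<noteq> 0" "subdegree y = l" using l by (simp_all add: y_def)
    obtain A where A: "psupp_dvd n A" "\<And>k. k \<le> l \<Longrightarrow> fps_nth (poly A \<phi>) k = fps_nth (comp_branch a n \<phi>) k"
      using comp_branch_approx[OF n \<phi>, of a l] by blast
    obtain B where B: "psupp_dvd n B" "\<And>k. k \<le> l \<Longrightarrow> fps_nth (poly B \<phi>) k = fps_nth (comp_branch b n \<phi>) k"
      using comp_branch_approx[OF n \<phi>, of b l] by blast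
    have "form n \<phi> A B \<noteq> 0 \<and> subdegree (form n \<phi> A B) = subdegree y"
      using agree[OF A(2) B(2)] y(2) by (intro subdegree_agree[OF y(1)]) (simp add: y_def)
    then show "l \<in> ?R" using y(2) A(1) B(1) by force
  next
    fix l assume "l \<in> ?R"
    then obtain A B where l: "l = subdegree (form n \<phi> A B)" "psupp_dvd n A" "psupp_dvd n B" "form n \<phi> A B \<noteq> 0"
      by auto
    obtain a where a: "conv2 a" "\<And>k. k \<le> l \<Longrightarrow> fps_nth (comp_branch a n \<phi>) k = fps_nth (poly A \<phi>) k"
      using poly_approx_conv[OF n \<phi> l(2), of l] by blast
    obtain b where b: "conv2 b" "\<And>k. k \<le> l \<Longrightarrow> fps_nth (comp_branch b n \<phi>) k = fps_nth (poly B \<phi>) k"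
      using poly_approx_conv[OF n \<phi> l(3), of l] by blast
    have "fps_nth (fps_X * pullback_form a b n \<phi>) k = fps_nth (form n \<phi> A B) k" if "k \<le> l" for k
      by (rule agree[OF a(2)[symmetric] b(2)[symmetric] that, symmetric])
    from subdegree_agree[OF l(4) this[unfolded l(1)]]
    have "fps_X * pullback_form a b n \<phi> \<noteq> 0 \<and> subdegree (fps_X * pullback_form a b n \<phi>) = l"
      by (simp only: l(1) simp_thms)
    then have "pullback_form a b n \<phi> \<noteq> 0 \<and> l = subdegree (pullback_form a b n \<phi>) + 1"
      by auto
    then show "l \<in> differential_values n \<phi>"
      unfolding differential_values_def using a(1) b(1) by blast
  qed
qed

lemma differential_valuesE:
  assumes "n > 0" "fps_nth \<phi> 0 = 0" "l \<in> differential_values n \<phi>"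
  obtains A B where "psupp_dvd n A" "psupp_dvd n B" "form n \<phi> A B \<noteq> 0" "l = subdegree (form n \<phi> A B)"
  using assms(3) unfolding differential_values_eq[OF assms(1,2)] by blast

lemma value_semigroupE:
  assumes "n > 0" "fps_nth \<phi> 0 = 0" "s \<in> value_semigroup n \<phi>"
  obtains P where "psupp_dvd n P" "fps_nth (coeff P 0) 0 = 0" "poly P \<phi> \<noteq> 0" "s = subdegree (poly P \<phi>)"
  using assms(3) unfolding value_semigroup_eq[OF assms(1,2)] by blast

lemma differential_valuesI:
  assumes "n > 0" "fps_nth \<phi> 0 = 0" "psupp_dvd n A" "psupp_dvd n B" "form n \<phi> A B \<noteq> 0"
  shows "subdegree (form n \<phi> A B) \<in> differential_values n \<phi>"
  unfolding differential_values_eq[OF assms(1,2)] using assms(3-5) by blast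

lemma value_semigroup_pos: 
  assumes "n > 0" "fps_nth \<phi> 0 = 0" "s \<in> value_semigroup n \<phi>" shows "s > 0"
proof -
  obtain P where P: "psupp_dvd n P" "fps_nth (coeff P 0) 0 = 0" "poly P \<phi> \<noteq> 0" "s = subdegree (poly P \<phi>)"
    by (rule value_semigroupE[OF assms])
  have "fps_nth (poly P \<phi>) 0 = 0" using P(2) assms(2) by (cases P) (auto simp: coeff_pCons)
  then show ?thesis using P(3,4) by (metis neq0_conv nth_subdegree_nonzero)
qed

lemma value_semigroup_add:
  assumes n: "n > 0" "fps_nth \<phi> 0 = 0" and s: "s \<in> value_semigroup n \<phi>" "s' \<in> value_semigroup n \<phi>"
  shows "s + s' \<in> value_semigroup n \<phi>"
proof -
  obtain P Q where "psupp_dvd n P" "fps_nth (coeff P 0) 0 = 0" "poly P \<phi> \<noteq> 0" "s = subdegree (poly P \<phi>)"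
     "psupp_dvd n Q" "fps_nth (coeff Q 0) 0 = 0" "poly Q \<phi> \<noteq> 0" "s' = subdegree (poly Q \<phi>)"
    using s unfolding value_semigroup_eq[OF n] by auto
  then have "psupp_dvd n (P * Q)" "fps_nth (coeff (P * Q) 0) 0 = 0" "poly (P * Q) \<phi> \<noteq> 0"
      "s + s' = subdegree (poly (P * Q) \<phi>)"
    by (auto intro: psupp_dvd_mult simp: coeff_mult)
  then show ?thesis unfolding value_semigroup_eq[OF n] by blast
qed

lemma differential_values_add:
  assumes n: "n > 0" "fps_nth \<phi> 0 = 0" and s: "l \<in> differential_values n \<phi>" "s \<in> value_semigroup n \<phi>"
  shows "l + s \<in> differential_values n \<phi>"
proof -
  obtain P A B where P: "psupp_dvd n P" "poly P \<phi> \<noteq> 0" "s = subdegree (poly P \<phi>)"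
     "psupp_dvd n A" "psupp_dvd n B" "form n \<phi> A B \<noteq> 0" "l = subdegree (form n \<phi> A B)"
    using s unfolding value_semigroup_eq[OF n] differential_values_eq[OF n] by auto
  have "form n \<phi> (P * A) (P * B) = poly P \<phi> * form n \<phi> A B"
    by (simp add: form_def algebra_simps)
  then have "form n \<phi> (P * A) (P * B) \<noteq> 0" "l + s = subdegree (form n \<phi> (P * A) (P * B))"
    using P by auto
  with P show ?thesis unfolding differential_values_eq[OF n] by (blast intro: psupp_dvd_mult)
qed

text \<open>The indecomposable elements lie in every generating set, and they generate: splitting
  off a positive s lowers l, so the descent ends. They are thus the only minimal generating
  set.\<close>

lemma S_basis_iff:
  assumes pos: "\<And>s. s \<in> S \<Longrightarrow> s > 0" and S: "\<And>s s'. s \<in> S \<Longrightarrow> s' \<in> S \<Longrightarrow> s + s' \<in> S"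
    and Lam: "\<And>l s. l \<in> Lam \<Longrightarrow> s \<in> S \<Longrightarrow> l + s \<in> Lam"
  shows "is_S_basis S Lam T \<longleftrightarrow> T = {l \<in> Lam. \<not> (\<exists>l'\<in>Lam. \<exists>s\<in>S. l = l' + s)}"
proof -
  define I where "I = {l \<in> Lam. \<not> (\<exists>l'\<in>Lam. \<exists>s\<in>S. l = l' + s)}"
  have ex: "\<exists>t\<in>I. \<exists>s\<in>S \<union> {0}. l = t + s" if "l \<in> Lam" for l
    using that
  proof (induction l rule: less_induct)
    case (less l)
    show ?case
    proof (cases "l \<in> I")
      case True then show ?thesis by (intro bexI[of _ l] bexI[of _ 0]) auto
    next
      case False
      then obtain l' s where ls: "l' \<in> Lam" "s \<in> S" "l = l' + s" using less.prems by (auto simp: I_def)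
      then have "l' < l" using pos by simp
      from less.IH[OF this ls(1)] obtain t s' where "t \<in> I" "s' \<in> S \<union> {0}" "l' = t + s'" by blast
      with ls S show ?thesis by (intro bexI[of _ t] bexI[of _ "s' + s"]) auto
    qed
  qed
  have "I \<subseteq> Lam" by (auto simp: I_def)
  moreover have "{t + s | t s. t \<in> I \<and> s \<in> S \<union> {0}} \<subseteq> Lam"
    using \<open>I \<subseteq> Lam\<close> Lam by auto
  moreover have "Lam \<subseteq> {t + s | t s. t \<in> I \<and> s \<in> S \<union> {0}}" using ex by blast
  ultimately have gen: "S_generates S Lam I" unfolding S_generates_def by (intro conjI equalityI)
  have sub: "I \<subseteq> T" if T: "S_generates S Lam T" for T
  proof
    fix l assume l: "l \<in> I"
    then have "l \<in> {t + s | t s. t \<in> T \<and> s \<in> S \<union> {0}}" using T by (auto simp: S_generates_def I_def)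
    then obtain t s where ts: "t \<in> T" "s \<in> S \<union> {0}" "l = t + s" by auto
    then have "t \<in> Lam" using T by (auto simp: S_generates_def)
    with l ts show "l \<in> T" by (auto simp: I_def)
  qed
  show ?thesis unfolding I_def[symmetric] is_S_basis_def using gen sub by (metis psubset_eq subset_antisym)
qed

theorem theorem1p3:
  fixes n :: nat and phi :: "complex fps"
  assumes singular: "n \<ge> 2"
    and convergent: "fps_conv_radius phi > 0"
    and puiseux_form: "\<And>b. b < puiseux_beta n phi 1 \<Longrightarrow> fps_nth phi b = 0"
    and multiplicity: "n < puiseux_beta n phi 1"
    and primitive: "\<And>d. d > 1 \<Longrightarrow> d dvd n \<Longrightarrow> \<exists>b. fps_nth phi b \<noteq> 0 \<and> \<not> d dvd b"
  shows "(\<exists>T. is_S_basis (value_semigroup n phi) (differential_values n phi) T)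
    \<and> (\<forall>T. is_S_basis (value_semigroup n phi) (differential_values n phi) T \<longrightarrow>
          n \<in> T \<and> (\<forall>j \<in> {1..puiseux_genus n phi}. puiseux_betabar n phi j \<in> T))"
proof -
  let ?S = "value_semigroup n phi" and ?L = "differential_values n phi"
  have base: "n > 0" "fps_nth phi 0 = 0" using singular puiseux_form[of 0] multiplicity by auto
  define I where "I = {l \<in> ?L. \<not> (\<exists>l'\<in>?L. \<exists>s\<in>?S. l = l' + s)}"
  have basis: "is_S_basis ?S ?L T \<longleftrightarrow> T = I" for T
    unfolding I_def
    by (rule S_basis_iff) (auto intro: value_semigroup_pos[OF base] value_semigroup_add[OF base] differential_values_add[OF base])
  have "n \<in> I"
  proof -
    have "form n phi 1 0 = theta (fps_X ^ n)" by (simp add: form_def)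
    moreover have "lead (int n) (of_nat n) (hat (theta (fps_X ^ n)))" by (auto simp: lead_fps theta_nth)
    then have "theta (fps_X ^ n) \<noteq> 0 \<and> subdegree (theta (fps_X ^ n)) = n"
      using base by (auto simp: lead_fps intro: subdegreeI)
    ultimately have "n \<in> ?L"
      using differential_valuesI[OF base psupp_dvd_1 psupp_dvd_0] by simp
    \<comment> \<open>\<open>n\<close> is the value of dx; it is the least value, because phi starts
      beyond t^n, and so it is indecomposable.\<close>
    moreover have "l \<ge> n" if l: "l \<in> ?L" for l
    proof -
      obtain A B where AB: "l = subdegree (form n phi A B)" "form n phi A B \<noteq> 0"
        using l unfolding differential_values_eq[OF base] by auto
      have "fps_nth (form n phi A B) k = 0" if "k < n" for k
        using that puiseux_form multiplicity
        by (auto simp: form_def fps_mult_nth theta_nth intro!: sum.neutral)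
      then show ?thesis using AB by (intro subdegree_geI[of "form n phi A B", folded AB(1)]) auto
    qed
    ultimately show ?thesis using value_semigroup_pos[OF base] unfolding I_def by fastforce
  qed
  moreover have "puiseux_betabar n phi j \<in> I" if j: "j \<in> {1..puiseux_genus n phi}" for j
  proof -
    interpret puiseux_level n phi "j - 1"
      by unfold_locales (use singular primitive j in auto)
    have total: "puiseux_betabar n phi j = total" using total_eq_betabar j by simp
    have "total > 0" using not_e_dvd_total by (auto intro!: Nat.gr0I)
    \<comment> \<open>\<open>total\<close> is the value of the exact form dF, F being
      \<open>semiroot\<close>: \<open>theta\<close> keeps the positive order of F along phi.\<close>
    obtain fx where fx: "smult (theta (fps_X ^ n)) fx = map_poly theta semiroot" "psupp_dvd n fx"
      using theta_div_X_power[OF semiroot_psupp base(1)] by blast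
    have "theta (poly semiroot phi) = form n phi fx (pderiv semiroot)"
      unfolding theta_poly form_def fx(1)[symmetric] by simp
    moreover have "theta (poly semiroot phi) \<noteq> 0 \<and> subdegree (theta (poly semiroot phi)) = total"
      using lead_theta[OF lead_semiroot] \<gamma>_nz[OF d_pos] \<Gamma>_nz \<open>total > 0\<close>
      by (auto simp: lead_fps intro: subdegreeI)
    ultimately have "total \<in> ?L"
      using differential_valuesI[OF base fx(2) psupp_dvd_pderiv[OF semiroot_psupp]] by simp
    moreover have "l + s \<noteq> total" if ls: "l \<in> ?L" "s \<in> ?S" for l s
    proof -
      obtain A B where AB: "psupp_dvd n A" "psupp_dvd n B" "form n phi A B \<noteq> 0" "l = subdegree (form n phi A B)"
        by (rule differential_valuesE[OF base ls(1)])
      obtain G where G: "psupp_dvd n G" "poly G phi \<noteq> 0" "s = subdegree (poly G phi)"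
        by (rule value_semigroupE[OF base ls(2)])
      show ?thesis using betabar_irreducible[OF AB(1,2) G(1), of "form n phi A B"] AB G
          value_semigroup_pos[OF base ls(2)] by (simp add: form_def theta_xn_def)
    qed
    ultimately show ?thesis unfolding I_def total by fastforce
  qed
  ultimately show ?thesis unfolding basis by blast
qed

end
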